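(* Let $\ell>0$ and let $f\in W^{1,2}(0,\ell)$ be complex-valued with $f(x)\neq0$ for all $x\in[0,\ell]$ and $f(0)=1$. For $\rho\in\mathbb{C}$ let $e_f(\rho,\cdot)\in\mathscr{D}_2(\mathbf{S}_f)$ be the unique solution of $\mathbf{S}_fy=\rho^2y$ on $(0,\ell)$ with $e_f(\rho,0)=1$, $\mathbf{D}_fe_f(\rho,0)=i\rho$. Then there exists a function $K_f\in L^2(\mathcal{T}_\ell)$ such that, for all $\rho\in\mathbb{C}$, $$e_f(\rho,x)=e^{i\rho x}+\int_{-x}^xK_f(x,t)e^{i\rho t}\,dt,\qquad 0<x<\ell.$$
   Context: All functions are complex-valued. $\mathcal{T}_\ell=\{(x,t)\in\mathbb{R}^2: 0\le x\le\ell,\ |t|\le x\}$. $\mathbf{D}_f y:=f(y/f)'=y'-\frac{f'}{f}y$ and $\mathbf{D}_{\frac1f}y:=\frac1f(fy)'=y'+\frac{f'}{f}y$ for $y\in W^{1,2}(0,\ell)$. $\mathbf{S}_f$ is the Schrödinger operator $-y''+q_fy$ on $J=(0,\ell)$ with distributional potential $q_f=\frac{f''}{f}\in W^{-1,2}(J)$, $(q_f|\phi)=\int_J\{(f'/f)^2\phi-(f'/f)\phi'\}dx$ for $\phi\in W^{1,2}_0(J)$, i.e. $(\mathbf{S}_fy|\phi)=\int_Jy'\phi'\,dx+(q_f|y\phi)$; its domain $\mathscr{D}_2(\mathbf{S}_f)$ is the set of $y\in W^{1,2}(J)$ for which the distribution $\mathbf{S}_fy$ is given by an $L^2(J)$ function.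 Equivalently, $\mathscr{D}_2(\mathbf{S}_f)=\{y\in W^{1,2}(J):\mathbf{D}_fy\in W^{1,2}(J)\}$ and $\mathbf{S}_fy=-\mathbf{D}_{\frac1f}\mathbf{D}_fy$. *)

theory Defs
  imports "HOL-Analysis.Analysis"
begin

text \<open>
  Elements of \<open>L\<^sup>2\<close> and of Sobolev spaces are represented by functions, not by equivalence classes.
  Every class has a Borel measurable representative, so \<open>lborel\<close> loses no generality.
\<close>

definition L2 :: "'a::euclidean_space set \<Rightarrow> ('a \<Rightarrow> complex) set" where
  "L2 A = {g. set_borel_measurable lborel A g \<and>
              set_integrable lborel A (\<lambda>x. (norm (g x))\<^sup>2)}"

definition smooth :: "(real \<Rightarrow> complex) \<Rightarrow> bool" where
  "smooth \<phi> \<longleftrightarrow> (\<exists>D :: nat \<Rightarrow> real \<Rightarrow> complex. D 0 = \<phi> \<and>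
      (\<forall>n x. (D n has_vector_derivative D (Suc n) x) (at x)))"

definition test_functions :: "real \<Rightarrow> (real \<Rightarrow> complex) set" where
  "test_functions l = {\<phi>. smooth \<phi> \<and>
      (\<exists>C. compact C \<and> C \<subseteq> {0<..<l} \<and> (\<forall>x. x \<notin> C \<longrightarrow> \<phi> x = 0))}"

definition is_weak_deriv :: "real \<Rightarrow> (real \<Rightarrow> complex) \<Rightarrow> (real \<Rightarrow> complex) \<Rightarrow> bool" where
  "is_weak_deriv l y g \<longleftrightarrow> (\<forall>\<phi>\<in>test_functions l.
      (LINT x:{0<..<l}|lborel. y x * vector_derivative \<phi> (at x)) =
      - (LINT x:{0<..<l}|lborel. g x * \<phi> x))"

text \<open>
  The space \<open>W\<^sup>1\<^sup>,\<^sup>2(0,l)\<close>. Its elements are represented by functions continuous on the closed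
  interval, so that values at all points of \<open>[0,l]\<close> make sense; values outside are irrelevant.
\<close>

definition W12 :: "real \<Rightarrow> (real \<Rightarrow> complex) set" where
  "W12 l = {y. continuous_on {0..l} y \<and> y \<in> L2 {0<..<l} \<and>
               (\<exists>g\<in>L2 {0<..<l}. is_weak_deriv l y g)}"

text \<open>A representative of the weak derivative; it is determined only almost everywhere.\<close>

definition wderiv :: "real \<Rightarrow> (real \<Rightarrow> complex) \<Rightarrow> real \<Rightarrow> complex" where
  "wderiv l y = (SOME g. g \<in> L2 {0<..<l} \<and> is_weak_deriv l y g)"

definition D_op :: "real \<Rightarrow> (real \<Rightarrow> complex) \<Rightarrow> (real \<Rightarrow> complex) \<Rightarrow> real \<Rightarrow> complex" where
  "D_op l f y = (\<lambda>x. wderiv l y x - wderiv l f x / f x * y x)"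

text \<open>The distributional potential \<open>q\<^sub>f = f'' / f\<close>.\<close>

definition q_dist :: "real \<Rightarrow> (real \<Rightarrow> complex) \<Rightarrow> (real \<Rightarrow> complex) \<Rightarrow> complex" where
  "q_dist l f \<phi> = (LINT x:{0<..<l}|lborel.
      (wderiv l f x / f x)\<^sup>2 * \<phi> x - (wderiv l f x / f x) * wderiv l \<phi> x)"

text \<open>The distribution \<open>- y'' + q\<^sub>f y\<close>.\<close>

definition S_dist ::
  "real \<Rightarrow> (real \<Rightarrow> complex) \<Rightarrow> (real \<Rightarrow> complex) \<Rightarrow> (real \<Rightarrow> complex) \<Rightarrow> complex" where
  "S_dist l f y \<phi> =
     (LINT x:{0<..<l}|lborel. wderiv l y x * vector_derivative \<phi> (at x)) +
     q_dist l f (\<lambda>x. y x * \<phi> x)"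

definition given_by :: "real \<Rightarrow> ((real \<Rightarrow> complex) \<Rightarrow> complex) \<Rightarrow> (real \<Rightarrow> complex) \<Rightarrow> bool" where
  "given_by l T h \<longleftrightarrow> (\<forall>\<phi>\<in>test_functions l. T \<phi> = (LINT x:{0<..<l}|lborel. h x * \<phi> x))"

definition dom_S :: "real \<Rightarrow> (real \<Rightarrow> complex) \<Rightarrow> (real \<Rightarrow> complex) set" where
  "dom_S l f = {y \<in> W12 l. \<exists>h\<in>L2 {0<..<l}. given_by l (S_dist l f y) h}"

text \<open>
  The initial value problem \<open>S\<^sub>f y = \<rho>\<^sup>2 y\<close>, \<open>y(0) = 1\<close>, \<open>D\<^sub>f y(0) = i \<rho>\<close>. For \<open>y\<close> in the domain,
  \<open>D\<^sub>f y\<close> belongs to \<open>W\<^sup>1\<^sup>,\<^sup>2(0,l)\<close>, and its value at \<open>0\<close> is that of its continuous representative \<open>v\<close>.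
\<close>

definition is_e_solution :: "real \<Rightarrow> (real \<Rightarrow> complex) \<Rightarrow> complex \<Rightarrow> (real \<Rightarrow> complex) \<Rightarrow> bool" where
  "is_e_solution l f \<rho> y \<longleftrightarrow>
     y \<in> dom_S l f \<and>
     given_by l (S_dist l f y) (\<lambda>x. \<rho>\<^sup>2 * y x) \<and>
     y 0 = 1 \<and>
     (\<exists>v\<in>W12 l. (AE x in lborel. x \<in> {0<..<l} \<longrightarrow> v x = D_op l f y x) \<and> v 0 = \<i> * \<rho>)"

definition triangle_dom :: "real \<Rightarrow> (real \<times> real) set" where
  "triangle_dom l = {(x, t). 0 \<le> x \<and> x \<le> l \<and> \<bar>t\<bar> \<le> x}"

end

theory Submission
  imports Defs
begin

text \<open>
  Put \<open>p = f' / f\<close>. The solution \<open>y\<close> and \<open>v = D\<^sub>f y\<close> satisfy \<open>y' = p y + v\<close>, \<open>v' = - p v - \<rho>\<^sup>2 y\<close> weakly,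
  hence in integrated form. For \<open>a, b = (y \<plusminus> v / (\<i> \<rho>)) / 2\<close> this becomes
  \<open>a' = \<i> \<rho> a + p b\<close>, \<open>b' = - \<i> \<rho> b + p a\<close>, a pair of Volterra equations with factors
  \<open>exp (\<plusminus> \<i> \<rho> (x - s))\<close>. Iterating them gives \<open>y = a + b\<close> as a Neumann series (for \<open>\<rho> = 0\<close> one has
  \<open>v = 0\<close> and iterates \<open>y = 1 + \<integral> p y\<close> directly). Every term after the first is the Fourier integral
  over \<open>[-x, x]\<close> of a kernel \<open>k\<^sub>n(x, t)\<close> not depending on \<open>\<rho>\<close>, and the Cauchy-Schwarz inequality bounds the
  square of its norm in \<open>L\<^sup>2(dt)\<close> by \<open>D (D x)\<^sup>n / (2 n!)\<close> with \<open>D = \<integral> |p|\<^sup>2\<close>. So \<open>K = \<Sum> k\<^sub>n\<close> is square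
  integrable, and the integral may be exchanged with the sum.
\<close>

subsection \<open>Smooth step functions\<close>

text \<open>The passage to integral equations is not free: the domain is defined by testing against
  smooth functions of compact support. Hence explicit smooth cut-offs are built first, and from them
  a fundamental theorem of calculus for weak derivatives, which also shows that weak derivatives are
  unique almost everywhere. The solution is given, not constructed. The Volterra equations are
  iterated on it, and the remainder is an iterate of a bounded function, so it tends to 0. As
  \<open>p\<close> is only square integrable, no bound on the kernels uniform in \<open>t\<close> is
  available: \<open>ker 0 x t\<close> is itself a rescaled value of \<open>p\<close>. Squared norms
  in \<open>t\<close> are used because Cauchy-Schwarz makes their recursion linear: each step costs
  a factor \<open>D\<close> and one integration over \<open>[0, x]\<close>, whence the factorial.
  Small squares do not by themselves give absolute convergence at a point. Inserting weights
  \<open>4 ^ n\<close>, which the factorial absorbs, gives it for almost every \<open>t\<close>. The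
  case \<rho> = 0 stands apart only because \<open>a\<close> and \<open>b\<close> divide by
  \<rho>.\<close>

lemma smooth_coinduct:
  assumes "P \<phi>" and step: "\<And>\<psi>. P \<psi> \<Longrightarrow> \<exists>\<psi>'. P \<psi>' \<and> (\<forall>x. (\<psi> has_vector_derivative \<psi>' x) (at x))"
  shows "smooth \<phi>"
proof -
  obtain N where N: "\<And>\<psi>. P \<psi> \<Longrightarrow> P (N \<psi>) \<and> (\<forall>x. (\<psi> has_vector_derivative N \<psi> x) (at x))"
    using step by metis
  \<comment> \<open>A choice function for derivatives within \<open>P\<close>, iterated from \<phi>,
    is the whole tower of derivatives that \<open>smooth\<close> asks for.\<close>
  define D where "D n = (N ^^ n) \<phi>" for n
  have "P (D n)" for n
    by (induction n) (use assms(1) N in \<open>auto simp: D_def\<close>)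
  then have "\<forall>n x. (D n has_vector_derivative D (Suc n) x) (at x)"
    using N by (auto simp: D_def)
  then show ?thesis
    unfolding smooth_def by (intro exI[of _ D]) (simp add: D_def)
qed

lemma smooth_cases:
  assumes "smooth \<phi>"
  obtains \<phi>' where "smooth \<phi>'" "\<And>x. (\<phi> has_vector_derivative \<phi>' x) (at x)"
proof -
  obtain D where D: "D 0 = \<phi>" "\<forall>n x. (D n has_vector_derivative D (Suc n) x) (at x)"
    using assms unfolding smooth_def by blast
  have "smooth (D 1)"
    unfolding smooth_def by (rule exI[of _ "\<lambda>n. D (Suc n)"]) (use D in auto)
  with that D show ?thesis by (metis One_nat_def)
qed

lemma smooth_if_deriv:
  assumes "\<And>x. (\<phi> has_vector_derivative \<phi>' x) (at x)" "smooth \<phi>'"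
  shows "smooth \<phi>"
proof -
  obtain D where D: "D 0 = \<phi>'" "\<forall>n x. (D n has_vector_derivative D (Suc n) x) (at x)"
    using assms unfolding smooth_def by blast
  show ?thesis
    unfolding smooth_def
    by (rule exI[of _ "\<lambda>n. case n of 0 \<Rightarrow> \<phi> | Suc m \<Rightarrow> D m"]) (use D assms in \<open>auto split: nat.split\<close>)
qed

lemma smooth_has_deriv:
  assumes "smooth \<phi>"
  shows "(\<phi> has_vector_derivative vector_derivative \<phi> (at x)) (at x)"
  using assms by (metis smooth_cases vector_derivative_at)

lemma smooth_vector_derivative: "smooth \<phi> \<Longrightarrow> smooth (\<lambda>x. vector_derivative \<phi> (at x))"
proof (erule smooth_cases)
  fix \<phi>' assume "smooth \<phi>'" "\<And>x. (\<phi> has_vector_derivative \<phi>' x) (at x)"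
  moreover have "(\<lambda>x. vector_derivative \<phi> (at x)) = \<phi>'"
    using calculation vector_derivative_at by blast
  ultimately show ?thesis by simp
qed

lemma smooth_continuous: "smooth \<phi> \<Longrightarrow> continuous_on A \<phi>"
  by (meson continuous_at_imp_continuous_on has_vector_derivative_continuous smooth_has_deriv)

text \<open>
  Sums of products of smooth functions are closed under differentiation, so products are smooth by
  coinduction, without the Leibniz formula for higher derivatives.
\<close>

inductive prod_span :: "(real \<Rightarrow> complex) \<Rightarrow> bool" where
  prod: "smooth u \<Longrightarrow> smooth v \<Longrightarrow> prod_span (\<lambda>x. u x * v x)"
| add: "prod_span u \<Longrightarrow> prod_span v \<Longrightarrow> prod_span (\<lambda>x. u x + v x)"

lemma smooth_const [intro]: "smooth (\<lambda>x. c)"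
  unfolding smooth_def
  by (rule exI[of _ "\<lambda>n x. if n = 0 then c else 0"]) auto

lemma smooth_prod_span: "prod_span u \<Longrightarrow> smooth u"
proof (rule smooth_coinduct[of prod_span])
  fix \<psi> assume "prod_span \<psi>"
  then show "\<exists>\<psi>'. prod_span \<psi>' \<and> (\<forall>x. (\<psi> has_vector_derivative \<psi>' x) (at x))"
  proof induction
    case (prod u v)
    obtain u' v' where u': "smooth u'" "\<And>x. (u has_vector_derivative u' x) (at x)"
      and v': "smooth v'" "\<And>x. (v has_vector_derivative v' x) (at x)"
      using prod smooth_cases by metis
    have "prod_span (\<lambda>x. u x * v' x + u' x * v x)"
      by (intro prod_span.intros prod u' v')
    moreover have "((\<lambda>x. u x * v x) has_vector_derivative u x * v' x + u' x * v x) (at x)" for x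
      by (intro has_vector_derivative_mult u' v')
    ultimately show ?case by blast
  next
    case (add u v)
    then obtain u' v' where "prod_span u'" "\<And>x. (u has_vector_derivative u' x) (at x)"
      "prod_span v'" "\<And>x. (v has_vector_derivative v' x) (at x)" by blast
    then show ?case
      by (intro exI[of _ "\<lambda>x. u' x + v' x"] conjI allI prod_span.intros has_vector_derivative_add) auto
  qed
qed

lemma smooth_mult: "smooth u \<Longrightarrow> smooth v \<Longrightarrow> smooth (\<lambda>x. u x * v x)"
  by (rule smooth_prod_span[OF prod_span.prod])

lemma smooth_add:
  assumes "smooth u" "smooth v" shows "smooth (\<lambda>x. u x + v x)"
  \<comment> \<open>The generators of \<open>prod_span\<close> are products, so each summand is
    written as a product with the constant 1.\<close>
  using smooth_prod_span[OF prod_span.add[OF prod_span.prod[OF assms(1) smooth_const[of 1]]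
    prod_span.prod[OF assms(2) smooth_const[of 1]]]] by simp

lemma smooth_cmult: "smooth v \<Longrightarrow> smooth (\<lambda>x. c * v x)"
  by (intro smooth_mult) auto

lemma smooth_diff: "smooth u \<Longrightarrow> smooth v \<Longrightarrow> smooth (\<lambda>x. u x - v x)"
  using smooth_add[of u "\<lambda>x. (-1) * v x"] smooth_cmult[of v "-1"] by simp

text \<open>Differentiating \<open>v (c * x + d)\<close> produces a factor \<open>c\<close>, so the
  class used in the coinduction must carry a real scalar \<open>a\<close>.\<close>

lemma smooth_affine:
  assumes "smooth u" shows "smooth (\<lambda>x. u (c * x + d))"
proof -
  have "smooth w" if "\<exists>v a. smooth v \<and> w = (\<lambda>x. of_real a * v (c * x + d))" for w
  proof (rule smooth_coinduct[where P = "\<lambda>w. \<exists>v a. smooth v \<and> w = (\<lambda>x. of_real a * v (c * x + d))", OF that])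
    fix \<psi> assume "\<exists>v a. smooth v \<and> \<psi> = (\<lambda>x. of_real a * v (c * x + d))"
    then obtain v a where v: "smooth v" "\<psi> = (\<lambda>x. of_real a * v (c * x + d))" by blast
    obtain v' where v': "smooth v'" "\<And>x. (v has_vector_derivative v' x) (at x)"
      using v smooth_cases by metis
    have "(\<psi> has_vector_derivative of_real (a * c) * v' (c * x + d)) (at x)" for x
    proof -
      have "((\<lambda>x. c * x + d) has_vector_derivative c) (at x)"
        by (auto intro!: derivative_eq_intros simp flip: has_real_derivative_iff_has_vector_derivative)
      then have "(v \<circ> (\<lambda>x. c * x + d) has_vector_derivative c *\<^sub>R v' (c * x + d)) (at x)"
        by (rule vector_diff_chain_at) (rule v')
      then show ?thesis
        unfolding v o_def by (auto intro!: derivative_eq_intros simp: scaleR_conv_of_real)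
    qed
    then show "\<exists>\<psi>'. (\<exists>v a. smooth v \<and> \<psi>' = (\<lambda>x. of_real a * v (c * x + d))) \<and>
        (\<forall>x. (\<psi> has_vector_derivative \<psi>' x) (at x))"
      using v' by (intro exI[of _ "\<lambda>x. of_real (a * c) * v' (c * x + d)"]) blast
  qed
  from this[of "\<lambda>x. u (c * x + d)"] show ?thesis
    using assms by (metis (no_types, lifting) mult_1 of_real_1)
qed

lemma has_vector_derivative_exp_cmult:
  fixes c :: complex
  shows "((\<lambda>x::real. exp (c * of_real x)) has_vector_derivative c * exp (c * of_real x)) (at x)"
proof -
  have "((\<lambda>z. exp (c * z)) has_field_derivative c * exp (c * of_real x)) (at (of_real x))"
    by (auto intro!: derivative_eq_intros)
  then show ?thesis
    using has_vector_derivative_real_field by blast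
qed

lemma smooth_exp: "smooth (\<lambda>x. exp (c * of_real x))"
proof -
  have "((\<lambda>x::real. c ^ n * exp (c * of_real x)) has_vector_derivative c ^ Suc n * exp (c * of_real x)) (at x)" for n x
    using has_vector_derivative_mult_right[OF has_vector_derivative_exp_cmult[of c x], of "c ^ n"]
    by (simp add: mult_ac)
  then show ?thesis
    unfolding smooth_def by (intro exI[of _ "\<lambda>n x. c ^ n * exp (c * of_real x)"]) auto
qed

text \<open>The classical function exp(-1/x), extended by 0, times a polynomial in 1/x. The
  polynomial is there to make the class closed under differentiation.\<close>

definition flat :: "real poly \<Rightarrow> real \<Rightarrow> real" where
  "flat P x = (if x \<le> 0 then 0 else poly P (1 / x) * exp (- (1 / x)))"

lemma poly_exp_tendsto_0: "((\<lambda>u::real. poly P u * exp (- u)) \<longlongrightarrow> 0) at_top"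
proof -
  have "((\<lambda>u. \<Sum>i\<le>degree P. coeff P i * (u ^ i / exp u)) \<longlongrightarrow> (\<Sum>i\<le>degree P. coeff P i * 0)) at_top"
    by (intro tendsto_intros tendsto_power_div_exp_0)
  then show ?thesis
    by (simp add: poly_altdef exp_minus sum_distrib_left divide_inverse mult_ac)
qed

text \<open>With u = 1/x one has u' = -u^2, so the derivative of P(u) exp(-u) is u^2 (P(u) - P'(u))
  exp(-u). At 0 the exponential beats the extra factor 1/h of the difference quotient.\<close>

lemma flat_has_derivative:
  "(flat P has_real_derivative flat (monom 1 2 * (P - pderiv P)) x) (at x)"
proof -
  consider "x < 0" | "x = 0" | "x > 0" by linarith
  then show ?thesis
  proof cases
    case 1
    have "((\<lambda>_. 0) has_real_derivative 0) (at x)" by simp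
    then have "(flat P has_real_derivative 0) (at x)"
      by (rule has_field_derivative_transform_within_open[of _ _ _ "{..<0}"])
        (use 1 in \<open>auto simp: flat_def\<close>)
    with 1 show ?thesis by (simp add: flat_def)
  next
    case 2
    have "((\<lambda>h. flat P h / h) \<longlongrightarrow> 0) (at_left 0)"
      by (rule tendsto_eventually) (auto simp: eventually_at flat_def intro!: exI[of _ 1])
    moreover have "((\<lambda>h. flat P h / h) \<longlongrightarrow> 0) (at_right 0)"
    proof -
      \<comment> \<open>\<open>pCons 0 P\<close> is X * P: dividing by h multiplies the polynomial
        in 1/h by its variable.\<close>
      have "((\<lambda>h. poly (pCons 0 P) (inverse h) * exp (- (inverse h))) \<longlongrightarrow> 0) (at_right 0)"
        by (rule filterlim_compose[OF poly_exp_tendsto_0 filterlim_inverse_at_top_right])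
      then show ?thesis
        by (rule Lim_transform_eventually)
          (auto simp: eventually_at flat_def divide_inverse mult_ac intro!: exI[of _ 1])
    qed
    ultimately have "((\<lambda>h. flat P h / h) \<longlongrightarrow> 0) (at 0)"
      by (simp add: filterlim_at_split)
    then show ?thesis using 2 by (simp add: DERIV_def flat_def)
  next
    case 3
    have "((\<lambda>x. poly P (1 / x) * exp (- (1 / x))) has_real_derivative
        poly (monom 1 2 * (P - pderiv P)) (1 / x) * exp (- (1 / x))) (at x)"
      using 3 by (auto intro!: derivative_eq_intros DERIV_chain2[OF poly_DERIV]
        simp: poly_monom field_simps power2_eq_square)
    then have "(flat P has_real_derivative
        poly (monom 1 2 * (P - pderiv P)) (1 / x) * exp (- (1 / x))) (at x)"
      by (rule has_field_derivative_transform_within_open[of _ _ _ "{0<..}"])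
        (use 3 in \<open>auto simp: flat_def\<close>)
    with 3 show ?thesis by (simp add: flat_def)
  qed
qed

lemma smooth_flat: "smooth (\<lambda>x. of_real (flat P x))"
proof (rule smooth_coinduct[where P = "\<lambda>u. \<exists>P. u = (\<lambda>x. of_real (flat P x))"])
  fix \<psi> :: "real \<Rightarrow> complex" assume "\<exists>P. \<psi> = (\<lambda>x. of_real (flat P x))"
  then obtain P where \<psi>: "\<psi> = (\<lambda>x. of_real (flat P x))" by blast
  show "\<exists>\<psi>'. (\<exists>P. \<psi>' = (\<lambda>x. of_real (flat P x))) \<and> (\<forall>x. (\<psi> has_vector_derivative \<psi>' x) (at x))"
    unfolding \<psi>
    by (intro exI[of _ "\<lambda>x. of_real (flat (monom 1 2 * (P - pderiv P)) x)"] conjI allI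
      exI[of _ "monom 1 2 * (P - pderiv P)"] refl has_vector_derivative_of_real flat_has_derivative)
qed auto

text \<open>Both functions serve later: rescaled copies of \<open>H\<close> approximate indicators
  of half-lines, and their derivatives, built from the probability density \<open>h\<close>, act as
  mollifiers.\<close>

lemma smooth_step:
  obtains H h :: "real \<Rightarrow> real" where
    "smooth (\<lambda>x. of_real (H x))" "\<And>x. (H has_real_derivative h x) (at x)"
    "\<And>x. 0 \<le> H x" "\<And>x. H x \<le> 1" "\<And>x. x \<le> 0 \<Longrightarrow> H x = 0" "\<And>x. 1 \<le> x \<Longrightarrow> H x = 1"
    "continuous_on UNIV h" "\<And>x. 0 \<le> h x" "\<And>x. x \<notin> {0..1} \<Longrightarrow> h x = 0"
proof -
  \<comment> \<open>A bump positive exactly on (0, 1): a flat function times its reflection.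
    \<open>H\<close> is its antiderivative, normalized to run from 0 to 1.\<close>
  define k where "k x = flat 1 x * flat 1 ((-1) * x + 1)" for x
  have k_smooth: "smooth (\<lambda>x. of_real (k x))"
    unfolding k_def of_real_mult by (intro smooth_mult smooth_flat smooth_affine[OF smooth_flat])
  have k_nonneg: "0 \<le> k x" for x by (simp add: k_def flat_def)
  have k_pos: "0 < k x" if "0 < x" "x < 1" for x using that by (simp add: k_def flat_def)
  have k_zero: "k x = 0" if "x \<notin> {0..1}" for x using that by (auto simp: k_def flat_def)
  have k_cont: "continuous_on A k" for A
    using continuous_on_Re[OF smooth_continuous[OF k_smooth]] by simp
  obtain F where F: "\<And>x. (F has_real_derivative k x) (at x)"
    using einterval_antiderivative[of "-\<infinity>" \<infinity> k] k_cont[of UNIV]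
    by (auto simp: has_real_derivative_iff_has_vector_derivative continuous_on_eq_continuous_at)
  have mono: "F x \<le> F y" if "x \<le> y" for x y
    using that DERIV_nonneg_imp_nondecreasing F k_nonneg by blast
  have Fc: "continuous_on A F" for A
    by (intro continuous_at_imp_continuous_on ballI DERIV_isCont[OF F])
  have left: "F x = F 0" if "x \<le> 0" for x
  proof (cases "x = 0")
    case False
    have "(F has_real_derivative 0) (at y)" if "x < y" "y < 0" for y
      using F[of y] k_zero[of y] that by simp
    with False have "F 0 = F x"
      using DERIV_isconst2[of x 0 F 0] that Fc by simp
    then show ?thesis by simp
  qed auto
  have right: "F x = F 1" if "1 \<le> x" for x
  proof (cases "x = 1")
    case False
    have "(F has_real_derivative 0) (at y)" if "1 < y" "y < x" for y
      using F[of y] k_zero[of y] that by simp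
    with False show ?thesis
      using DERIV_isconst2[of 1 x F x] that Fc by simp
  qed auto
  have "F 0 < F 1"
    by (rule DERIV_pos_imp_increasing_open[of 0 1 F])
      (use F k_pos Fc in auto)
  define c where "c = F 1 - F 0"
  have c: "c > 0" using \<open>F 0 < F 1\<close> by (simp add: c_def)
  define H where "H x = (F x - F 0) / c" for x
  have H: "(H has_real_derivative k x / c) (at x)" for x
    unfolding H_def using c by (auto intro!: derivative_eq_intros F)
  show thesis
  proof (rule that[of H "\<lambda>x. k x / c"])
    show "smooth (\<lambda>x. of_real (H x))"
    proof (rule smooth_if_deriv)
      show "((\<lambda>x. of_real (H x)) has_vector_derivative complex_of_real (k x / c)) (at x)" for x
        by (intro has_vector_derivative_of_real H)
      show "smooth (\<lambda>x. complex_of_real (k x / c))"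
        using smooth_cmult[OF k_smooth, of "1 / of_real c"] by simp
    qed
    show "0 \<le> H x" for x
      using mono[of 0 x] left[of x] c by (cases "x \<le> 0") (auto simp: H_def)
    show "H x \<le> 1" for x
      using mono[of x 1] right[of x] c by (cases "x \<le> 1") (auto simp: H_def c_def)
    show "H x = 0" if "x \<le> 0" for x using left[OF that] by (simp add: H_def)
    show "H x = 1" if "1 \<le> x" for x
      using right[OF that] \<open>F 0 < F 1\<close> by (simp add: H_def c_def)
    show "continuous_on UNIV (\<lambda>x. k x / c)"
      using c by (intro continuous_intros k_cont) auto
  qed (use H k_nonneg k_zero c in auto)
qed

subsection \<open>Weak derivatives of continuous functions\<close>

text \<open>Substituting x = c + z / m gives the integral of u(c + z / m) h(z), to which dominated
  convergence applies with majorant B h. The argument of \<open>h\<close> is written as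
  \<open>m n * x + - m n * c\<close> to have the affine form of
  \<open>smooth_affine\<close>.\<close>

lemma mollifier_tendsto:
  fixes u :: "real \<Rightarrow> complex" and h :: "real \<Rightarrow> real"
  assumes u[measurable]: "u \<in> borel_measurable borel" and B: "\<And>x. norm (u x) \<le> B" and "isCont u c"
    and h: "\<And>x. 0 \<le> h x" "has_bochner_integral lborel h 1"
    and m: "\<And>n. 0 < m n" "filterlim m at_top sequentially"
  shows "integrable lborel (\<lambda>x. u x * of_real (m n * h (m n * x + - m n * c)))" (is ?int)
    and "(\<lambda>n. LINT x|lborel. u x * of_real (m n * h (m n * x + - m n * c))) \<longlonglongrightarrow> u c" (is ?lim)
proof -
  have [measurable]: "h \<in> borel_measurable borel" and h_int: "integrable lborel h"
    using h(2) borel_measurable_has_bochner_integral by (fastforce intro: has_bochner_integral_integrable dest: integrable.intros)+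
  have B0: "0 \<le> B" using B[of 0] norm_ge_zero order_trans by blast
  have eq: "u (c + 1 / m n * z) * of_real (m n * h (m n * (c + 1 / m n * z) + - m n * c))
      = of_real (m n) * (u (c + 1 / m n * z) * of_real (h z))" for n z
    using m(1)[of n] by (simp add: field_simps)
  have bound: "integrable lborel (\<lambda>z. u (c + 1 / m n * z) * of_real (h z))" for n
    by (rule Bochner_Integration.integrable_bound[of _ "\<lambda>z. B * h z"])
      (use h_int h B B0 in \<open>auto simp: norm_mult intro!: mult_mono\<close>)
  show ?int
    using lborel_integrable_real_affine_iff[of "1 / m n" "\<lambda>x. u x * of_real (m n * h (m n * x + - m n * c))" c]
      m(1)[of n] integrable_mult_right[OF bound, of "of_real (m n)" n] unfolding eq by simp
  have "(LINT x|lborel. u x * of_real (m n * h (m n * x + - m n * c)))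
      = (LINT z|lborel. u (c + 1 / m n * z) * of_real (h z))" for n
    using lborel_integral_real_affine[of "1 / m n" "\<lambda>x. u x * of_real (m n * h (m n * x + - m n * c))" c]
      m(1)[of n] unfolding eq by (simp add: scaleR_conv_of_real)
  moreover have "(\<lambda>n. LINT z|lborel. u (c + 1 / m n * z) * of_real (h z)) \<longlonglongrightarrow> (LINT z|lborel. u c * of_real (h z))"
  proof (rule integral_dominated_convergence[where w = "\<lambda>z. B * h z"])
    show "AE z in lborel. (\<lambda>n. u (c + 1 / m n * z) * of_real (h z)) \<longlonglongrightarrow> u c * of_real (h z)"
    proof (intro always_eventually allI tendsto_mult tendsto_const isCont_tendsto_compose[OF \<open>isCont u c\<close>])
      fix z
      have "(\<lambda>n. 1 / m n * z) \<longlonglongrightarrow> 0"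
        by (intro tendsto_mult_left_zero tendsto_divide_0[OF tendsto_const] filterlim_at_top_imp_at_infinity m)
      then show "(\<lambda>n. c + 1 / m n * z) \<longlonglongrightarrow> c"
        using tendsto_add[OF tendsto_const] by fastforce
    qed
  qed (use h_int h B B0 in \<open>auto simp: norm_mult intro!: mult_mono\<close>)
  moreover have "(LINT z|lborel. u c * of_real (h z)) = u c"
    using h(2) by (simp add: has_bochner_integral_integral_eq)
  ultimately show ?lim by (simp only:)
qed

text \<open>
  Testing with smooth steps that approximate the indicator of \<open>]a, b]\<close> yields the integral on one side
  and mollified values of \<open>y\<close> at \<open>a\<close> and \<open>b\<close> on the other.
\<close>

lemma weak_deriv_integral_interior:
  assumes y: "continuous_on {0..l} y" and g: "set_integrable lborel {0<..<l} g"
    and wd: "is_weak_deriv l y g" and ab: "0 < a" "a < b" "b < l"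
  shows "(LINT x:{a<..<b}|lborel. g x) = y b - y a"
proof -
  obtain H h where smooth_H: "smooth (\<lambda>x. complex_of_real (H x))"
    and H: "\<And>x. (H has_real_derivative h x) (at x)" "\<And>x. 0 \<le> H x" "\<And>x. H x \<le> 1"
      "\<And>x. x \<le> 0 \<Longrightarrow> H x = 0" "\<And>x. 1 \<le> x \<Longrightarrow> H x = 1"
    and h: "continuous_on UNIV h" "\<And>x. 0 \<le> h x" "\<And>x. x \<notin> {0..1} \<Longrightarrow> h x = 0"
    by (rule smooth_step) blast
  \<comment> \<open>Chosen so that 1 / M < l - b. Every step of slope parameter \<open>m n\<close>,
    being at least \<open>M\<close>, is completed before \<open>b + e\<close> < l, which keeps the
    supports inside the open interval.\<close>
  define M where "M = 1 / (l - b) + 1"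
  define m where "m n = real n + M" for n
  define e where "e = 1 / M"
  have M: "M > 0" and "M > 1 / (l - b)" using ab by (auto simp: M_def intro: add_pos_pos)
  then have e: "b + e < l" "e > 0"
    using ab by (auto simp: e_def field_simps)
  have m: "0 < m n" "M \<le> m n" for n using M by (auto simp: m_def)
  have m_lim: "filterlim m at_top sequentially"
    unfolding m_def using filterlim_tendsto_add_at_top[OF tendsto_const[of M] filterlim_real_sequentially]
    by (simp add: add.commute)
  define \<phi> where "\<phi> n x = complex_of_real (H (m n * x + - m n * a)) - of_real (H (m n * x + - m n * b))" for n x
  have \<phi>_test: "\<phi> n \<in> test_functions l" for n
    unfolding test_functions_def
  proof (intro CollectI conjI exI[of _ "{a..b+e}"] allI impI)
    show "smooth (\<phi> n)"
      unfolding \<phi>_def by (intro smooth_diff smooth_affine[OF smooth_H])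
    fix x assume "x \<notin> {a..b + e}"
    then consider "x < a" | "x > b + e" by force
    then show "\<phi> n x = 0"
    proof cases
      case 1
      then have "m n * x \<le> m n * a" "m n * x \<le> m n * b" using m[of n] ab by auto
      then show ?thesis by (simp add: \<phi>_def H)
    next
      case 2
      have "1 = M * e" using M by (simp add: e_def)
      also have "\<dots> \<le> m n * e" using m e by (intro mult_right_mono) auto
      also have "\<dots> \<le> m n * (x - b)" using m[of n] 2 by (intro mult_left_mono) auto
      finally have *: "1 \<le> m n * (x - b)" .
      also have "\<dots> \<le> m n * (x - a)" using m[of n] ab by (intro mult_left_mono) auto
      finally have "1 \<le> m n * (x - a)" .
      with * show ?thesis by (simp add: \<phi>_def H algebra_simps)
    qed
  qed (use ab e in auto)
  have H': "((\<lambda>x. complex_of_real (H (m n * x + - m n * c))) has_vector_derivative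
      of_real (m n * h (m n * x + - m n * c))) (at x)" for n c x
  proof (rule has_vector_derivative_of_real)
    have "((\<lambda>x. m n * x + - m n * c) has_real_derivative m n) (at x)"
      by (auto intro!: derivative_eq_intros)
    from DERIV_chain2[OF H(1) this]
    show "((\<lambda>x. H (m n * x + - m n * c)) has_real_derivative m n * h (m n * x + - m n * c)) (at x)"
      by (simp only: mult.commute)
  qed
  have \<phi>': "vector_derivative (\<phi> n) (at x)
      = of_real (m n * h (m n * x + - m n * a)) - of_real (m n * h (m n * x + - m n * b))" for n x
    unfolding \<phi>_def by (intro vector_derivative_at has_vector_derivative_diff H')
  \<comment> \<open>Extension by zero makes \<open>y\<close> Borel and bounded on the whole line, as
    the mollifier requires. Continuity is kept at \<open>a\<close> and \<open>b\<close>, which are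
    interior points.\<close>
  define u where "u x = indicator {0<..<l} x *\<^sub>R y x" for x
  have u_meas: "u \<in> borel_measurable borel"
    unfolding u_def
    by (rule borel_measurable_continuous_on_indicator[of "{0<..<l}" y, unfolded])
      (auto intro: continuous_on_subset[OF y])
  obtain B where B: "\<And>x. x \<in> {0..l} \<Longrightarrow> norm (y x) \<le> B"
    using compact_imp_bounded[OF compact_continuous_image[OF y compact_Icc]]
    unfolding bounded_iff by (auto simp del: atLeastAtMost_iff)
  have "0 \<le> B" using B[of a] ab by (auto intro: order_trans[OF norm_ge_zero])
  then have u_bound: "norm (u x) \<le> B" for x
    using B[of x] by (auto simp: u_def indicator_def)
  have u_cont: "isCont u c" if "c \<in> {0<..<l}" for c
  proof -
    have "continuous_on {0<..<l} u"
      by (rule continuous_on_eq[OF continuous_on_subset[OF y]]) (auto simp: u_def)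
    then show ?thesis using that continuous_on_eq_continuous_at open_greaterThanLessThan by blast
  qed
  have h_bi: "has_bochner_integral lborel h 1"
  proof -
    have "has_bochner_integral lborel (\<lambda>x. h x * indicator {0..1} x) (H 1 - H 0)"
      by (rule has_bochner_integral_FTC_Icc_nonneg)
        (use H h in \<open>auto intro: borel_measurable_continuous_onI\<close>)
    moreover have "(\<lambda>x. h x * indicator {0..1} x) = h"
      using h(3) by (auto simp: fun_eq_iff indicator_def)
    ultimately show ?thesis using H by simp
  qed
  note mol = mollifier_tendsto[OF u_meas u_bound _ h(2) h_bi m(1) m_lim]
  have eq: "(LINT x:{0<..<l}|lborel. y x * vector_derivative (\<phi> n) (at x))
     = (LINT x|lborel. u x * of_real (m n * h (m n * x + - m n * a)))
     - (LINT x|lborel. u x * of_real (m n * h (m n * x + - m n * b)))" for n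
  proof -
    have "(LINT x:{0<..<l}|lborel. y x * vector_derivative (\<phi> n) (at x))
      = (LINT x|lborel. u x * of_real (m n * h (m n * x + - m n * a))
          - u x * of_real (m n * h (m n * x + - m n * b)))"
      unfolding set_lebesgue_integral_def \<phi>'
      by (intro Bochner_Integration.integral_cong) (auto simp: u_def algebra_simps)
    also have "\<dots> = (LINT x|lborel. u x * of_real (m n * h (m n * x + - m n * a)))
       - (LINT x|lborel. u x * of_real (m n * h (m n * x + - m n * b)))"
      by (intro Bochner_Integration.integral_diff mol(1) u_cont) (use ab in auto)
    finally show ?thesis .
  qed
  have "(\<lambda>n. LINT x:{0<..<l}|lborel. y x * vector_derivative (\<phi> n) (at x)) \<longlonglongrightarrow> u a - u b"
    unfolding eq using ab by (intro tendsto_diff mol(2) u_cont) auto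
  moreover have "u a - u b = y a - y b" using ab by (simp add: u_def)
  ultimately have L1: "(\<lambda>n. LINT x:{0<..<l}|lborel. y x * vector_derivative (\<phi> n) (at x)) \<longlonglongrightarrow> y a - y b"
    by simp
  define G where "G x = indicator {0<..<l} x *\<^sub>R g x" for x
  have gi: "integrable lborel G"
    using g by (simp add: G_def[abs_def] set_integrable_def)
  then have [measurable]: "G \<in> borel_measurable borel" by auto
  have \<phi>_meas[measurable]: "\<phi> n \<in> borel_measurable borel" for n
    using \<phi>_test[of n] by (auto simp: test_functions_def intro!: borel_measurable_continuous_onI smooth_continuous)
  have step_lim: "(\<lambda>n. complex_of_real (H (m n * x + - m n * c))) \<longlonglongrightarrow> (if x > c then 1 else 0)" for x c
  proof (cases "x > c")
    case True
    have "filterlim (\<lambda>n. (x - c) * m n) at_top sequentially"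
      using filterlim_tendsto_pos_mult_at_top[OF tendsto_const _ m_lim, of "x - c"] True by simp
    then have "eventually (\<lambda>n. 1 \<le> (x - c) * m n) sequentially"
      unfolding filterlim_at_top by auto
    then have "eventually (\<lambda>n. complex_of_real (H (m n * x + - m n * c)) = 1) sequentially"
      by eventually_elim (simp add: H algebra_simps)
    then show ?thesis using True by (simp add: tendsto_eventually)
  next
    case False
    then have "m n * x + - m n * c \<le> 0" for n using m[of n] by auto
    then show ?thesis using False by (simp add: H)
  qed
  \<comment> \<open>The difference of the two limiting steps is the indicator of a half-open
    interval; the endpoint \<open>b\<close> is discarded below as a null set.\<close>
  have "(\<lambda>n. LINT x|lborel. G x * \<phi> n x) \<longlonglongrightarrow>
      (LINT x|lborel. G x * ((if x > a then 1 else 0) - (if x > b then 1 else 0)))"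
  proof (rule integral_dominated_convergence[where w = "\<lambda>x. norm (G x)"])
    show "AE x in lborel. norm (G x * \<phi> n x) \<le> norm (G x)" for n
    proof (intro always_eventually allI)
      fix x
      have "\<bar>H (m n * x + - m n * a) - H (m n * x + - m n * b)\<bar> \<le> 1"
        using H(2,3)[of "m n * x + - m n * a"] H(2,3)[of "m n * x + - m n * b"] by linarith
      then have "norm (\<phi> n x) \<le> 1"
        unfolding \<phi>_def by (metis norm_of_real of_real_diff)
      then show "norm (G x * \<phi> n x) \<le> norm (G x)"
        unfolding norm_mult using mult_left_le by fastforce
    qed
    show "AE x in lborel. (\<lambda>n. G x * \<phi> n x) \<longlonglongrightarrow>
        G x * ((if x > a then 1 else 0) - (if x > b then 1 else 0))"
      unfolding \<phi>_def by (intro always_eventually allI tendsto_intros step_lim)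
  qed (use gi in auto)
  moreover have "(LINT x|lborel. G x * ((if x > a then 1 else 0) - (if x > b then 1 else 0)))
      = (LINT x:{a<..<b}|lborel. g x)"
    unfolding set_lebesgue_integral_def
  proof (rule integral_cong_AE)
    have "AE x in lborel. x \<noteq> b" by (rule AE_lborel_singleton)
    then show "AE x in lborel. G x * ((if x > a then 1 else 0) - (if x > b then 1 else 0))
        = indicator {a<..<b} x *\<^sub>R g x"
      by eventually_elim (use ab in \<open>auto simp: G_def indicator_def\<close>)
    have "set_integrable lborel {a<..<b} g"
      by (rule set_integrable_subset[OF g]) (use ab in auto)
    then show "(\<lambda>x. indicator {a<..<b} x *\<^sub>R g x) \<in> borel_measurable lborel"
      unfolding set_integrable_def by (rule borel_measurable_integrable)
  qed measurable
  moreover have "(LINT x|lborel. G x * \<phi> n x)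
      = - (LINT x:{0<..<l}|lborel. y x * vector_derivative (\<phi> n) (at x))" for n
    using wd \<phi>_test[of n] unfolding is_weak_deriv_def set_lebesgue_integral_def by (simp add: G_def)
  ultimately have "(\<lambda>n. - (LINT x:{0<..<l}|lborel. y x * vector_derivative (\<phi> n) (at x)))
      \<longlonglongrightarrow> (LINT x:{a<..<b}|lborel. g x)" by simp
  from LIMSEQ_unique[OF this tendsto_minus[OF L1]] show ?thesis by simp
qed

text \<open>The closed case follows by exhausting the interval from inside: continuity of
  \<open>y\<close> up to the boundary handles one side, integrability of \<open>g\<close> the
  other.\<close>

lemma weak_deriv_integral:
  assumes y: "continuous_on {0..l} y" and g: "set_integrable lborel {0<..<l} g"
    and wd: "is_weak_deriv l y g" and ab: "0 \<le> a" "a \<le> b" "b \<le> l"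
  shows "(LINT x:{a<..<b}|lborel. g x) = y b - y a"
proof (cases "a = b")
  case False
  \<comment> \<open>With \<open>n + 3\<close> the margin is at most a third of the length, so the
    shrunken interval never becomes empty.\<close>
  define d where "d n = (b - a) / real (n + 3)" for n
  have d: "0 < d n" "d n < (b - a) / 2" for n
    using False ab divide_strict_left_mono[of 2 "real (n + 3)" "b - a"] by (auto simp: d_def)
  have d_lim: "d \<longlonglongrightarrow> 0"
    unfolding d_def by (rule LIMSEQ_ignore_initial_segment[OF lim_const_over_n])
  have y_lim: "(\<lambda>n. y (X n)) \<longlonglongrightarrow> y c" if "X \<longlonglongrightarrow> c" "\<And>n. X n \<in> {0..l}" "c \<in> {0..l}" for X c
    using y that unfolding continuous_on_sequentially by (auto simp: o_def)
  have inside: "a + d n \<in> {0<..<l}" "b - d n \<in> {0<..<l}" "a + d n < b - d n" for n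
    using d[of n] ab False by auto
  have "(\<lambda>n. y (b - d n) - y (a + d n)) \<longlonglongrightarrow> y b - y a"
    using inside ab tendsto_diff[OF tendsto_const d_lim, of b] tendsto_add[OF tendsto_const d_lim, of a]
    by (intro tendsto_diff y_lim) (auto simp: less_imp_le)
  moreover have "(\<lambda>n. LINT x:{a + d n<..<b - d n}|lborel. g x) \<longlonglongrightarrow> (LINT x:{a<..<b}|lborel. g x)"
    unfolding set_lebesgue_integral_def
  proof (rule integral_dominated_convergence[where w = "\<lambda>x. norm (indicator {0<..<l} x *\<^sub>R g x)"])
    show "AE x in lborel. (\<lambda>n. indicator {a + d n<..<b - d n} x *\<^sub>R g x) \<longlonglongrightarrow> indicator {a<..<b} x *\<^sub>R g x"
    proof (intro always_eventually allI tendsto_scaleR tendsto_const)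
      fix x
      show "(\<lambda>n. indicat_real {a + d n<..<b - d n} x) \<longlonglongrightarrow> indicat_real {a<..<b} x"
      proof (cases "x \<in> {a<..<b}")
        case True
        have "eventually (\<lambda>n. d n < min (x - a) (b - x)) sequentially"
          using True by (intro order_tendstoD(2)[OF d_lim]) auto
        then have "eventually (\<lambda>n. indicat_real {a + d n<..<b - d n} x = 1) sequentially"
          by eventually_elim auto
        then show ?thesis using True by (simp add: tendsto_eventually)
      next
        case F: False
        have "indicat_real {a + d n<..<b - d n} x = 0" for n
          using F d[of n] by (auto simp: indicator_def)
        with F show ?thesis by simp
      qed
    qed
    have si: "set_integrable lborel S g" if "S \<subseteq> {0<..<l}" "S \<in> sets lborel" for S
      using set_integrable_subset[OF g that(2,1)] .
    show "(\<lambda>x. indicator {a<..<b} x *\<^sub>R g x) \<in> borel_measurable lborel"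
      using si[of "{a<..<b}"] ab unfolding set_integrable_def
      by (intro borel_measurable_integrable) (auto simp: subset_eq)
    show "(\<lambda>x. indicator {a + d n<..<b - d n} x *\<^sub>R g x) \<in> borel_measurable lborel" for n
      using si[of "{a + d n<..<b - d n}"] inside[of n] unfolding set_integrable_def
      by (intro borel_measurable_integrable) (auto simp: subset_eq)
    show "AE x in lborel. norm (indicator {a + d n<..<b - d n} x *\<^sub>R g x)
        \<le> norm (indicator {0<..<l} x *\<^sub>R g x)" for n
      using inside[of n] by (auto simp: indicator_def)
    show "integrable lborel (\<lambda>x. norm (indicator {0<..<l} x *\<^sub>R g x))"
      using g unfolding set_integrable_def by (rule integrable_norm)
  qed
  moreover have "(LINT x:{a + d n<..<b - d n}|lborel. g x) = y (b - d n) - y (a + d n)" for n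
    using weak_deriv_integral_interior[OF y g wd] inside[of n] by auto
  ultimately show ?thesis using LIMSEQ_unique by auto
qed (auto simp: set_lebesgue_integral_def)

text \<open>For a real function, the positive and the negative part are densities of two measures
  that agree on all open half-lines. Hence the measures coincide and so do the densities almost
  everywhere, which forces both parts to vanish. Real and imaginary parts are then treated
  separately.\<close>

lemma AE_zero_if_interval_integrals_zero:
  fixes g :: "real \<Rightarrow> complex"
  assumes g: "set_integrable lborel {0<..<l} g"
    and zero: "\<And>a b. 0 \<le> a \<Longrightarrow> a \<le> b \<Longrightarrow> b \<le> l \<Longrightarrow> (LINT x:{a<..<b}|lborel. g x) = 0"
  shows "AE x in lborel. x \<in> {0<..<l} \<longrightarrow> g x = 0"
proof -
  have real_case: "AE x in lborel. u x = 0"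
    if u: "integrable lborel u" and u0: "\<And>x. (LINT s|lborel. indicator {x<..} s * u s) = 0" for u :: "real \<Rightarrow> real"
  proof -
    have [measurable]: "u \<in> borel_measurable borel" using u by auto
    define v where "v s x = ennreal (max 0 (s * u x))" for s :: real and x
    have [measurable]: "v s \<in> borel_measurable borel" for s unfolding v_def by measurable
    have i: "integrable lborel (\<lambda>t. indicator {x<..} t * max 0 (s * u t))" for s x
      by (rule Bochner_Integration.integrable_bound[of _ "\<lambda>t. s * u t"]) (use u in \<open>auto simp: indicator_def\<close>)
    have em: "emeasure (density lborel (v s)) {x<..} = ennreal (LINT t|lborel. indicator {x<..} t * max 0 (s * u t))" for x s
      by (subst emeasure_density, measurable, subst nn_integral_eq_integral[symmetric, OF i])
        (auto simp: v_def intro!: nn_integral_cong split: split_indicator)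
    have "density lborel (v 1) = density lborel (v (-1))"
    proof (rule measure_eqI_lessThan)
      fix x
      have "(LINT t|lborel. indicator {x<..} t * max 0 (1 * u t)) - (LINT t|lborel. indicator {x<..} t * max 0 ((-1) * u t))
        = (LINT t|lborel. indicator {x<..} t * u t)"
        by (subst Bochner_Integration.integral_diff[symmetric, OF i i])
          (auto intro!: Bochner_Integration.integral_cong split: split_indicator)
      then show "emeasure (density lborel (v 1)) {x<..} = emeasure (density lborel (v (-1))) {x<..}"
        unfolding em using u0[of x] by simp
    qed (auto simp: em)
    then have "AE x in lborel. v 1 x = v (-1) x"
      by (subst (asm) sigma_finite_measure.density_unique_iff[OF sigma_finite_lborel]) auto
    then show ?thesis
      by eventually_elim (auto simp: v_def max_def split: if_splits)
  qed
  define G where "G x = indicator {0<..<l} x *\<^sub>R g x" for x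
  have G: "integrable lborel G" using g by (simp add: G_def[abs_def] set_integrable_def)
  have "(LINT s|lborel. indicator {x<..} s *\<^sub>R G s) = 0" for x
  proof -
    have "(\<lambda>s. indicator {x<..} s *\<^sub>R G s) = (\<lambda>s. indicator {min l (max 0 x)<..<l} s *\<^sub>R g s)"
      by (auto simp: G_def indicator_def fun_eq_iff)
    then show ?thesis using zero[of "min l (max 0 x)" l] by (cases "l \<ge> 0") (auto simp: set_lebesgue_integral_def)
  qed
  note * = this
  have "(LINT s|lborel. indicator {x<..} s * Re (G s)) = 0" "(LINT s|lborel. indicator {x<..} s * Im (G s)) = 0" for x
  proof -
    have i: "integrable lborel (\<lambda>s. indicator {x<..} s *\<^sub>R G s)"
      by (rule integrable_mult_indicator) (use G in auto)
    show "(LINT s|lborel. indicator {x<..} s * Re (G s)) = 0" "(LINT s|lborel. indicator {x<..} s * Im (G s)) = 0"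
      using integral_Re[OF i] integral_Im[OF i] *[of x] by auto
  qed
  then have "AE x in lborel. Re (G x) = 0" "AE x in lborel. Im (G x) = 0"
    using real_case[of "\<lambda>x. Re (G x)"] real_case[of "\<lambda>x. Im (G x)"] G by auto
  then show ?thesis
    by eventually_elim (auto simp: G_def complex_eq_iff)
qed

text \<open>Two weak derivatives have the same integral over every interval, by the fundamental
  theorem. This is what makes the arbitrary choice in \<open>wderiv\<close> harmless.\<close>

lemma weak_deriv_unique:
  assumes y: "continuous_on {0..l} y"
    and g1: "set_integrable lborel {0<..<l} g1" "is_weak_deriv l y g1"
    and g2: "set_integrable lborel {0<..<l} g2" "is_weak_deriv l y g2"
  shows "AE x in lborel. x \<in> {0<..<l} \<longrightarrow> g1 x = g2 x"
proof -
  have "AE x in lborel. x \<in> {0<..<l} \<longrightarrow> g1 x - g2 x = 0"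
  proof (rule AE_zero_if_interval_integrals_zero)
    fix a b assume ab: "0 \<le> a" "a \<le> b" "b \<le> l"
    have "set_integrable lborel {a<..<b} g1" "set_integrable lborel {a<..<b} g2"
      by (rule set_integrable_subset[OF g1(1)] set_integrable_subset[OF g2(1)]; use ab in auto)+
    then show "(LINT x:{a<..<b}|lborel. g1 x - g2 x) = 0"
      using weak_deriv_integral[OF y g1 ab] weak_deriv_integral[OF y g2 ab]
      by (simp add: set_integral_diff)
  qed (use g1 g2 in \<open>simp add: set_integral_diff\<close>)
  then show ?thesis by simp
qed

subsection \<open>Reduction to Volterra equations\<close>

lemma set_integral_cong_AE_integrable:
  fixes u w :: "real \<Rightarrow> complex"
  assumes "set_integrable lborel A u" "set_integrable lborel A w"
    "AE x in lborel. x \<in> A \<longrightarrow> u x = w x"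
  shows "(LINT x:A|lborel. u x) = (LINT x:A|lborel. w x)"
  using assms unfolding set_integrable_def set_lebesgue_integral_def
  by (intro integral_cong_AE borel_measurable_integrable) (auto elim!: eventually_mono simp: indicator_def)

lemma set_borel_measurable_mult:
  fixes u w :: "'a \<Rightarrow> complex"
  assumes "set_borel_measurable M A u" "set_borel_measurable M A w"
  shows "set_borel_measurable M A (\<lambda>x. u x * w x)"
proof -
  have "(\<lambda>x. (indicator A x *\<^sub>R u x) * (indicator A x *\<^sub>R w x)) \<in> borel_measurable M"
    using assms unfolding set_borel_measurable_def by measurable
  moreover have "(\<lambda>x. (indicator A x *\<^sub>R u x) * (indicator A x *\<^sub>R w x)) = (\<lambda>x. indicator A x *\<^sub>R (u x * w x))"
    by (auto simp: fun_eq_iff indicator_def)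
  ultimately show ?thesis by (simp add: set_borel_measurable_def)
qed

lemma continuous_set_borel_measurable:
  fixes c :: "real \<Rightarrow> complex"
  assumes "continuous_on {0..l} c"
  shows "set_borel_measurable lborel {0<..<l} c"
  unfolding set_borel_measurable_def
  using borel_measurable_continuous_on_indicator[of "{0<..<l}" c]
    continuous_on_subset[OF assms greaterThanLessThan_subseteq_atLeastAtMost_iff[THEN iffD2]] by auto

lemma continuous_bounded_Icc:
  fixes c :: "real \<Rightarrow> complex"
  assumes "continuous_on {0..l} c"
  obtains B where "B \<ge> 0" "\<And>x. x \<in> {0<..<l} \<Longrightarrow> norm (c x) \<le> B"
proof -
  obtain B where "\<forall>x\<in>{0..l}. norm (c x) \<le> B"
    using compact_imp_bounded[OF compact_continuous_image[OF assms compact_Icc]]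
    unfolding bounded_iff by (auto simp del: atLeastAtMost_iff)
  then have "norm (c x) \<le> max 0 B" if "x \<in> {0<..<l}" for x
    using that by (force intro: max.coboundedI2)
  then show thesis by (intro that[of "max 0 B"]) auto
qed

lemma set_integrable_mult_continuous:
  fixes g c :: "real \<Rightarrow> complex"
  assumes g: "set_integrable lborel {0<..<l} g" and c: "continuous_on {0..l} c"
  shows "set_integrable lborel {0<..<l} (\<lambda>x. g x * c x)"
proof -
  obtain B where B: "B \<ge> 0" "\<And>x. x \<in> {0<..<l} \<Longrightarrow> norm (c x) \<le> B"
    using continuous_bounded_Icc[OF c] by blast
  have m: "set_borel_measurable lborel {0<..<l} g"
    using g unfolding set_integrable_def set_borel_measurable_def by auto
  show ?thesis
    unfolding set_integrable_def
  proof (rule Bochner_Integration.integrable_bound)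
    show "integrable lborel (\<lambda>x. B *\<^sub>R norm (indicator {0<..<l} x *\<^sub>R g x))"
      using g unfolding set_integrable_def by (intro integrable_scaleR_right integrable_norm)
    show "(\<lambda>x. indicator {0<..<l} x *\<^sub>R (g x * c x)) \<in> borel_measurable lborel"
      using set_borel_measurable_mult[OF m continuous_set_borel_measurable[OF c]]
      by (simp add: set_borel_measurable_def)
    show "AE x in lborel. norm (indicator {0<..<l} x *\<^sub>R (g x * c x)) \<le> norm (B *\<^sub>R norm (indicator {0<..<l} x *\<^sub>R g x))"
      using B by (intro always_eventually allI)
        (auto simp: indicator_def norm_mult mult.commute[of "norm (g _)"] intro!: mult_right_mono)
  qed
qed

lemma set_integrable_continuous:
  fixes c :: "real \<Rightarrow> complex"
  assumes "continuous_on {0..l} c"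
  shows "set_integrable lborel {0<..<l} c"
proof -
  have "set_integrable lborel {0<..<l} (\<lambda>x. 1 :: complex)"
    unfolding set_integrable_def by (cases "l \<ge> 0") (auto simp: emeasure_lborel_Ioo)
  from set_integrable_mult_continuous[OF this assms] show ?thesis by simp
qed

lemma L2_mult_integrable:
  fixes g h :: "real \<Rightarrow> complex"
  assumes "g \<in> L2 A" "h \<in> L2 A"
  shows "set_integrable lborel A (\<lambda>x. g x * h x)"
  unfolding set_integrable_def
proof (rule Bochner_Integration.integrable_bound)
  show "integrable lborel (\<lambda>x. indicator A x *\<^sub>R (norm (g x))\<^sup>2 + indicator A x *\<^sub>R (norm (h x))\<^sup>2)"
    using assms unfolding L2_def set_integrable_def by auto
  show "(\<lambda>x. indicator A x *\<^sub>R (g x * h x)) \<in> borel_measurable lborel"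
    using assms set_borel_measurable_mult[of lborel A g h] by (simp add: set_borel_measurable_def L2_def)
  have "norm (g x * h x) \<le> (norm (g x))\<^sup>2 + (norm (h x))\<^sup>2" for x
    using sum_squares_bound[of "norm (g x)" "norm (h x)"] mult_nonneg_nonneg[OF norm_ge_zero norm_ge_zero, of "g x" "h x"]
    unfolding norm_mult by linarith
  then show "AE x in lborel. norm (indicator A x *\<^sub>R (g x * h x)) \<le> norm (indicator A x *\<^sub>R (norm (g x))\<^sup>2 + indicator A x *\<^sub>R (norm (h x))\<^sup>2)"
    by (auto simp: indicator_def)
qed

lemma L2_mult_continuous:
  fixes g c :: "real \<Rightarrow> complex"
  assumes g: "g \<in> L2 {0<..<l}" and c: "continuous_on {0..l} c"
  shows "(\<lambda>x. g x * c x) \<in> L2 {0<..<l}"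
proof -
  have cc: "continuous_on {0..l} (\<lambda>x. complex_of_real ((norm (c x))\<^sup>2))"
    using c by (intro continuous_intros)
  \<comment> \<open>The squared modulus is regarded as a complex function so that the product rule
    for a continuous factor can be reused.\<close>
  have "integrable lborel (\<lambda>x. complex_of_real (indicat_real {0<..<l} x *\<^sub>R (norm (g x))\<^sup>2))"
    using g by (intro integrable_of_real) (simp only: L2_def set_integrable_def mem_Collect_eq)
  then have "set_integrable lborel {0<..<l} (\<lambda>x. complex_of_real ((norm (g x))\<^sup>2))"
    by (simp add: set_integrable_def scaleR_conv_of_real)
  from set_integrable_norm[OF set_integrable_mult_continuous[OF this cc]]
  have "set_integrable lborel {0<..<l} (\<lambda>x. (norm (g x * c x))\<^sup>2)"
    by (simp add: norm_mult power_mult_distrib norm_power)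
  moreover have "set_borel_measurable lborel {0<..<l} (\<lambda>x. g x * c x)"
    using g set_borel_measurable_mult[OF _ continuous_set_borel_measurable[OF c], of g] by (simp add: L2_def)
  ultimately show ?thesis by (simp add: L2_def)
qed

lemma L2_continuous:
  fixes c :: "real \<Rightarrow> complex"
  assumes c: "continuous_on {0..l} c" shows "c \<in> L2 {0<..<l}"
proof -
  have "continuous_on {0..l} (\<lambda>x. c x * cnj (c x))"
    using c by (intro continuous_intros)
  then have "set_integrable lborel {0<..<l} (\<lambda>x. norm (c x * cnj (c x)))"
    by (intro set_integrable_norm set_integrable_continuous)
  then show ?thesis
    using continuous_set_borel_measurable[OF c] by (simp add: L2_def norm_mult power2_eq_square)
qed

lemma L2_integrable: "g \<in> L2 {0<..<l::real} \<Longrightarrow> set_integrable lborel {0<..<l} g"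
  using L2_mult_integrable[of g "{0<..<l}" "\<lambda>_. 1"] L2_continuous[of l "\<lambda>_. 1"] by auto

lemma L2_add:
  assumes "g \<in> L2 A" "h \<in> L2 A" shows "(\<lambda>x. g x + h x) \<in> L2 A"
proof -
  have [measurable]: "(\<lambda>x. indicator A x *\<^sub>R g x) \<in> borel_measurable lborel" "(\<lambda>x. indicator A x *\<^sub>R h x) \<in> borel_measurable lborel"
    using assms by (auto simp: L2_def set_borel_measurable_def)
  have meas: "(\<lambda>x. indicator A x *\<^sub>R (g x + h x)) \<in> borel_measurable lborel"
    unfolding scaleR_add_right by measurable
  have "integrable lborel (\<lambda>x. indicator A x *\<^sub>R (norm (g x + h x))\<^sup>2)"
  proof (rule Bochner_Integration.integrable_bound)
    show "integrable lborel (\<lambda>x. 2 * (indicator A x *\<^sub>R (norm (g x))\<^sup>2 + indicator A x *\<^sub>R (norm (h x))\<^sup>2))"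
      using assms unfolding L2_def set_integrable_def by auto
    have "(\<lambda>x. (norm (indicator A x *\<^sub>R (g x + h x)))\<^sup>2) \<in> borel_measurable lborel"
      using meas by measurable
    also have "(\<lambda>x. (norm (indicator A x *\<^sub>R (g x + h x)))\<^sup>2) = (\<lambda>x. indicator A x *\<^sub>R (norm (g x + h x))\<^sup>2)"
      by (auto simp: indicator_def)
    finally show "(\<lambda>x. indicator A x *\<^sub>R (norm (g x + h x))\<^sup>2) \<in> borel_measurable lborel" .
    have "(norm (g x + h x))\<^sup>2 \<le> 2 * ((norm (g x))\<^sup>2 + (norm (h x))\<^sup>2)" for x
    proof -
      have "(norm (g x + h x))\<^sup>2 \<le> (norm (g x) + norm (h x))\<^sup>2"
        by (intro power_mono norm_triangle_ineq) auto
      also have "\<dots> \<le> 2 * ((norm (g x))\<^sup>2 + (norm (h x))\<^sup>2)"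
        using sum_squares_bound[of "norm (g x)" "norm (h x)"] by (simp add: power2_sum)
      finally show ?thesis .
    qed
    then show "AE x in lborel. norm (indicator A x *\<^sub>R (norm (g x + h x))\<^sup>2)
        \<le> norm (2 * (indicator A x *\<^sub>R (norm (g x))\<^sup>2 + indicator A x *\<^sub>R (norm (h x))\<^sup>2))"
      by (auto simp: indicator_def)
  qed
  then show ?thesis
    using meas by (simp add: L2_def set_borel_measurable_def set_integrable_def)
qed

section \<open>Calculus of weak derivatives and the first-order system\<close>

lemma wderiv_properties:
  assumes "y \<in> W12 l"
  shows "wderiv l y \<in> L2 {0<..<l}" "is_weak_deriv l y (wderiv l y)"
  using assms someI_ex[of "\<lambda>g. g \<in> L2 {0<..<l} \<and> is_weak_deriv l y g"]
  unfolding W12_def wderiv_def by auto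

lemma test_functionsD:
  assumes "\<phi> \<in> test_functions l"
  shows "smooth \<phi>" "continuous_on A \<phi>" "continuous_on A (\<lambda>x. vector_derivative \<phi> (at x))"
  using assms smooth_continuous smooth_vector_derivative by (auto simp: test_functions_def)

lemma vector_derivative_smooth_mult:
  "smooth \<phi> \<Longrightarrow> smooth \<psi> \<Longrightarrow> vector_derivative (\<lambda>x. \<phi> x * \<psi> x) (at x)
    = \<phi> x * vector_derivative \<psi> (at x) + vector_derivative \<phi> (at x) * \<psi> x"
  by (intro vector_derivative_at has_vector_derivative_mult smooth_has_deriv)

lemma test_functions_mult_smooth:
  assumes "smooth \<phi>" "\<psi> \<in> test_functions l"
  shows "(\<lambda>x. \<phi> x * \<psi> x) \<in> test_functions l"
  using assms by (auto simp: test_functions_def intro!: smooth_mult)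

text \<open>If \<psi> is a test function, so is \<phi> \<psi>. Testing \<open>y\<close> with this
  product and subtracting the term with \<phi>' \<psi> gives the Leibniz rule.\<close>

lemma is_weak_deriv_mult_smooth:
  assumes y: "continuous_on {0..l} y" and g: "set_integrable lborel {0<..<l} g"
    and wd: "is_weak_deriv l y g" and \<phi>: "smooth \<phi>"
  shows "is_weak_deriv l (\<lambda>x. y x * \<phi> x) (\<lambda>x. g x * \<phi> x + y x * vector_derivative \<phi> (at x))"
  unfolding is_weak_deriv_def
proof
  fix \<psi> assume \<psi>: "\<psi> \<in> test_functions l"
  note cont = smooth_continuous[OF \<phi>] smooth_continuous[OF smooth_vector_derivative[OF \<phi>]] test_functionsD(2,3)[OF \<psi>] y
  let ?I = "\<lambda>u. LINT x:{0<..<l}|lborel. u x"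
  have i1: "set_integrable lborel {0<..<l} (\<lambda>x. y x * vector_derivative (\<lambda>x. \<phi> x * \<psi> x) (at x))"
    unfolding vector_derivative_smooth_mult[OF \<phi> test_functionsD(1)[OF \<psi>]]
    by (intro set_integrable_continuous continuous_intros cont)
  have i2: "set_integrable lborel {0<..<l} (\<lambda>x. y x * vector_derivative \<phi> (at x) * \<psi> x)"
    by (intro set_integrable_continuous continuous_intros cont)
  have i3: "set_integrable lborel {0<..<l} (\<lambda>x. g x * (\<phi> x * \<psi> x))"
    by (intro set_integrable_mult_continuous g continuous_intros cont)
  have "?I (\<lambda>x. y x * \<phi> x * vector_derivative \<psi> (at x))
    = ?I (\<lambda>x. y x * vector_derivative (\<lambda>x. \<phi> x * \<psi> x) (at x) - y x * vector_derivative \<phi> (at x) * \<psi> x)"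
    unfolding vector_derivative_smooth_mult[OF \<phi> test_functionsD(1)[OF \<psi>]]
    by (simp add: algebra_simps)
  also have "\<dots> = ?I (\<lambda>x. y x * vector_derivative (\<lambda>x. \<phi> x * \<psi> x) (at x)) - ?I (\<lambda>x. y x * vector_derivative \<phi> (at x) * \<psi> x)"
    by (rule set_integral_diff(2)[OF i1 i2])
  also have "?I (\<lambda>x. y x * vector_derivative (\<lambda>x. \<phi> x * \<psi> x) (at x)) = - ?I (\<lambda>x. g x * (\<phi> x * \<psi> x))"
    using wd test_functions_mult_smooth[OF \<phi> \<psi>] unfolding is_weak_deriv_def by blast
  also have "- ?I (\<lambda>x. g x * (\<phi> x * \<psi> x)) - ?I (\<lambda>x. y x * vector_derivative \<phi> (at x) * \<psi> x)
    = - ?I (\<lambda>x. g x * (\<phi> x * \<psi> x) + y x * vector_derivative \<phi> (at x) * \<psi> x)"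
    by (simp add: set_integral_add(2)[OF i3 i2])
  finally show "?I (\<lambda>x. y x * \<phi> x * vector_derivative \<psi> (at x))
      = - ?I (\<lambda>x. (g x * \<phi> x + y x * vector_derivative \<phi> (at x)) * \<psi> x)"
    by (simp add: algebra_simps)
qed

lemma is_weak_deriv_lincomb:
  assumes y: "continuous_on {0..l} y" "set_integrable lborel {0<..<l} g" "is_weak_deriv l y g"
    and w: "continuous_on {0..l} w" "set_integrable lborel {0<..<l} h" "is_weak_deriv l w h"
  shows "is_weak_deriv l (\<lambda>x. a * y x + b * w x) (\<lambda>x. a * g x + b * h x)"
  unfolding is_weak_deriv_def
proof
  fix \<phi> assume \<phi>: "\<phi> \<in> test_functions l"
  let ?I = "\<lambda>u. LINT x:{0<..<l}|lborel. u x"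
  note cont = test_functionsD(2,3)[OF \<phi>] y(1) w(1)
  have i: "set_integrable lborel {0<..<l} (\<lambda>x. a * (y x * vector_derivative \<phi> (at x)))"
    "set_integrable lborel {0<..<l} (\<lambda>x. b * (w x * vector_derivative \<phi> (at x)))"
    by (intro set_integrable_continuous continuous_intros cont)+
  have j: "set_integrable lborel {0<..<l} (\<lambda>x. a * (g x * \<phi> x))" "set_integrable lborel {0<..<l} (\<lambda>x. b * (h x * \<phi> x))"
    by (intro set_integrable_mult_right impI set_integrable_mult_continuous y w cont)+
  have "?I (\<lambda>x. (a * y x + b * w x) * vector_derivative \<phi> (at x))
    = ?I (\<lambda>x. a * (y x * vector_derivative \<phi> (at x)) + b * (w x * vector_derivative \<phi> (at x)))"
    by (simp add: algebra_simps)
  also have "\<dots> = - ?I (\<lambda>x. a * (g x * \<phi> x) + b * (h x * \<phi> x))"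
    unfolding set_integral_add(2)[OF i] set_integral_add(2)[OF j] set_integral_mult_right
    using y(3) w(3) \<phi> by (simp add: is_weak_deriv_def algebra_simps)
  finally show "?I (\<lambda>x. (a * y x + b * w x) * vector_derivative \<phi> (at x))
    = - ?I (\<lambda>x. (a * g x + b * h x) * \<phi> x)"
    by (simp add: algebra_simps)
qed

lemma is_weak_deriv_cong_AE:
  assumes "is_weak_deriv l y g" "set_integrable lborel {0<..<l} g" "set_integrable lborel {0<..<l} h"
    "AE x in lborel. x \<in> {0<..<l} \<longrightarrow> g x = h x"
  shows "is_weak_deriv l y h"
  unfolding is_weak_deriv_def
proof
  fix \<phi> assume \<phi>: "\<phi> \<in> test_functions l"
  have "(LINT x:{0<..<l}|lborel. g x * \<phi> x) = (LINT x:{0<..<l}|lborel. h x * \<phi> x)"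
    using assms(4) test_functionsD(2)[OF \<phi>]
    by (intro set_integral_cong_AE_integrable set_integrable_mult_continuous assms(2,3)) (auto elim!: eventually_mono)
  then show "(LINT x:{0<..<l}|lborel. y x * vector_derivative \<phi> (at x)) = - (LINT x:{0<..<l}|lborel. h x * \<phi> x)"
    using assms(1) \<phi> by (simp add: is_weak_deriv_def)
qed

text \<open>
  The distribution \<open>q_dist\<close> contains an arbitrarily chosen weak derivative of \<open>y \<phi>\<close>. By uniqueness
  almost everywhere it may be replaced by \<open>y' \<phi> + y \<phi>'\<close>, and what remains is the weak form of the
  second equation.
\<close>

lemma e_solution_system:
  assumes f: "f \<in> W12 l" "\<forall>x\<in>{0..l}. f x \<noteq> 0" and e: "is_e_solution l f \<rho> y"
    and p: "\<And>x. x \<in> {0<..<l} \<Longrightarrow> p x = wderiv l f x / f x"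
  obtains v where "continuous_on {0..l} y" "continuous_on {0..l} v" "y 0 = 1" "v 0 = \<i> * \<rho>"
    "p \<in> L2 {0<..<l}"
    "is_weak_deriv l y (\<lambda>x. p x * y x + v x)"
    "is_weak_deriv l v (\<lambda>x. - (p x * v x + \<rho>\<^sup>2 * y x))"
proof -
  let ?J = "{0<..<l}"
  let ?I = "\<lambda>u. LINT x:{0<..<l}|lborel. u x"
  obtain v where v: "v \<in> W12 l" "AE x in lborel. x \<in> ?J \<longrightarrow> v x = D_op l f y x" "v 0 = \<i> * \<rho>"
    and y: "y \<in> W12 l" "y 0 = 1" "given_by l (S_dist l f y) (\<lambda>x. \<rho>\<^sup>2 * y x)"
    using e unfolding is_e_solution_def dom_S_def by blast
  have cont: "continuous_on {0..l} y" "continuous_on {0..l} v" "continuous_on {0..l} f"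
    using y(1) v(1) f(1) by (auto simp: W12_def)
  have pL2: "p \<in> L2 ?J"
  proof -
    have "continuous_on {0..l} (\<lambda>x. inverse (f x))"
      using f cont by (intro continuous_intros) auto
    from L2_mult_continuous[OF wderiv_properties(1)[OF f(1)] this]
    have "(\<lambda>x. wderiv l f x * inverse (f x)) \<in> L2 ?J" .
    moreover have "(\<lambda>x. indicator ?J x *\<^sub>R (wderiv l f x * inverse (f x))) = (\<lambda>x. indicator ?J x *\<^sub>R p x)"
      "(\<lambda>x. indicat_real ?J x *\<^sub>R (norm (wderiv l f x * inverse (f x)))\<^sup>2) = (\<lambda>x. indicat_real ?J x *\<^sub>R (norm (p x))\<^sup>2)"
      by (auto simp: p indicator_def fun_eq_iff divide_inverse)
    ultimately show ?thesis
      by (simp only: L2_def set_borel_measurable_def set_integrable_def mem_Collect_eq)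
  qed
  let ?y' = "wderiv l y"
  note y' = wderiv_properties[OF y(1)]
  have v_eq: "AE x in lborel. x \<in> ?J \<longrightarrow> ?y' x = p x * y x + v x"
    using v(2) by eventually_elim (auto simp: D_op_def p)
  have i_py: "(\<lambda>x. p x * y x) \<in> L2 ?J" "(\<lambda>x. p x * v x) \<in> L2 ?J"
    by (rule L2_mult_continuous[OF pL2], rule cont)+
  have wd_y: "is_weak_deriv l y (\<lambda>x. p x * y x + v x)"
    by (rule is_weak_deriv_cong_AE[OF y'(2) L2_integrable[OF y'(1)] _ v_eq])
      (rule L2_integrable[OF L2_add[OF i_py(1) L2_continuous[OF cont(2)]]])
  have "is_weak_deriv l v (\<lambda>x. - (p x * v x + \<rho>\<^sup>2 * y x))"
    unfolding is_weak_deriv_def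
  proof
    fix \<phi> assume \<phi>: "\<phi> \<in> test_functions l"
    let ?\<phi>' = "\<lambda>x. vector_derivative \<phi> (at x)"
    note ct = test_functionsD(2,3)[OF \<phi>] cont
    let ?g = "\<lambda>x. ?y' x * \<phi> x + y x * ?\<phi>' x"
    have g: "?g \<in> L2 ?J" "is_weak_deriv l (\<lambda>x. y x * \<phi> x) ?g"
      using L2_add[OF L2_mult_continuous[OF y'(1) ct(1)] L2_continuous[OF continuous_on_mult[OF cont(1) ct(2)]]]
        is_weak_deriv_mult_smooth[OF cont(1) L2_integrable[OF y'(1)] y'(2) test_functionsD(1)[OF \<phi>]] by auto
    have c_y\<phi>: "continuous_on {0..l} (\<lambda>x. y x * \<phi> x)"
      using ct by (intro continuous_intros)
    have y\<phi>: "(\<lambda>x. y x * \<phi> x) \<in> W12 l"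
      using g L2_continuous[OF c_y\<phi>] c_y\<phi> unfolding W12_def by blast
    note w = wderiv_properties[OF y\<phi>]
    have w_eq: "AE x in lborel. x \<in> ?J \<longrightarrow> wderiv l (\<lambda>x. y x * \<phi> x) x = ?g x"
      by (rule weak_deriv_unique[OF c_y\<phi> L2_integrable[OF w(1)] w(2) L2_integrable[OF g(1)] g(2)])
    have i_pp: "set_integrable lborel ?J (\<lambda>x. p x * p x * (y x * \<phi> x))"
      by (rule set_integrable_mult_continuous[OF L2_mult_integrable[OF pL2 pL2] c_y\<phi>])
    have i_q: "set_integrable lborel ?J (\<lambda>x. p x * p x * (y x * \<phi> x) - p x * wderiv l (\<lambda>x. y x * \<phi> x) x)"
      by (rule set_integral_diff(1)[OF i_pp L2_mult_integrable[OF pL2 w(1)]])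
    have i_y': "set_integrable lborel ?J (\<lambda>x. ?y' x * ?\<phi>' x)"
      by (rule set_integrable_mult_continuous[OF L2_integrable[OF y'(1)] ct(2)])
    have i_v: "set_integrable lborel ?J (\<lambda>x. v x * ?\<phi>' x)"
      using ct by (intro set_integrable_continuous continuous_intros)
    have i_pv: "set_integrable lborel ?J (\<lambda>x. p x * v x * \<phi> x)"
      by (rule set_integrable_mult_continuous[OF L2_integrable[OF i_py(2)] ct(1)])
    have i_\<rho>: "set_integrable lborel ?J (\<lambda>x. \<rho>\<^sup>2 * y x * \<phi> x)"
      using ct by (intro set_integrable_continuous continuous_intros)
    have "q_dist l f (\<lambda>x. y x * \<phi> x) = ?I (\<lambda>x. p x * p x * (y x * \<phi> x) - p x * wderiv l (\<lambda>x. y x * \<phi> x) x)"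
      unfolding q_dist_def by (intro set_lebesgue_integral_cong) (auto simp: p power2_eq_square)
    then have "S_dist l f y \<phi> = ?I (\<lambda>x. ?y' x * ?\<phi>' x + (p x * p x * (y x * \<phi> x) - p x * wderiv l (\<lambda>x. y x * \<phi> x) x))"
      unfolding S_dist_def by (simp add: set_integral_add(2)[OF i_y' i_q])
    \<comment> \<open>Insert y' = p y + v and (y \<phi>)' = y' \<phi> + y \<phi>'. The terms p y
      \<phi>' cancel, and so do the terms with p^2; this removes the distributional
      potential.\<close>
    also have "\<dots> = ?I (\<lambda>x. v x * ?\<phi>' x - p x * v x * \<phi> x)"
    proof (rule set_integral_cong_AE_integrable)
      show "AE x in lborel. x \<in> ?J \<longrightarrow> ?y' x * ?\<phi>' x + (p x * p x * (y x * \<phi> x) - p x * wderiv l (\<lambda>x. y x * \<phi> x) x)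
          = v x * ?\<phi>' x - p x * v x * \<phi> x"
        using w_eq v_eq by eventually_elim (auto simp: algebra_simps)
    qed (intro set_integral_add(1) set_integral_diff(1) i_y' i_q i_v i_pv)+
    also have "\<dots> = ?I (\<lambda>x. v x * ?\<phi>' x) - ?I (\<lambda>x. p x * v x * \<phi> x)"
      by (rule set_integral_diff(2)[OF i_v i_pv])
    finally have "?I (\<lambda>x. v x * ?\<phi>' x) = ?I (\<lambda>x. p x * v x * \<phi> x) + ?I (\<lambda>x. \<rho>\<^sup>2 * y x * \<phi> x)"
      using y(3) \<phi> by (simp add: given_by_def)
    also have "\<dots> = ?I (\<lambda>x. p x * v x * \<phi> x + \<rho>\<^sup>2 * y x * \<phi> x)"
      by (rule set_integral_add(2)[OF i_pv i_\<rho>, symmetric])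
    also have "\<dots> = - ?I (\<lambda>x. - (p x * v x * \<phi> x + \<rho>\<^sup>2 * y x * \<phi> x))"
      by (simp only: set_lebesgue_integral_def scaleR_minus_right Bochner_Integration.integral_minus minus_minus)
    finally show "?I (\<lambda>x. v x * ?\<phi>' x) = - ?I (\<lambda>x. - (p x * v x + \<rho>\<^sup>2 * y x) * \<phi> x)"
      by (simp add: algebra_simps)
  qed
  with that cont y(2) v(3) pL2 wd_y show thesis by blast
qed

text \<open>The Duhamel integral: formally the solution of z' = c z + p u with z(0) = 0.\<close>

definition volterra :: "(real \<Rightarrow> complex) \<Rightarrow> complex \<Rightarrow> (real \<Rightarrow> complex) \<Rightarrow> real \<Rightarrow> complex" where
  "volterra p c u x = (LINT s:{0<..<x}|lborel. p s * exp (c * of_real (x - s)) * u s)"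

text \<open>The integrating factor exp(-c x) is smooth, so the Leibniz rule applies to its product
  with \<open>y\<close>; the weak derivative of that product is p u exp(-c x), which can be
  integrated from 0.\<close>

lemma variation_of_constants:
  assumes y: "continuous_on {0..l} y" and u: "continuous_on {0..l} u" and p: "p \<in> L2 {0<..<l}"
    and wd: "is_weak_deriv l y (\<lambda>x. c * y x + p x * u x)" and x: "x \<in> {0..l}"
  shows "y x = y 0 * exp (c * of_real x) + volterra p c u x"
proof -
  let ?E = "\<lambda>x. exp (- c * complex_of_real x)"
  have E': "vector_derivative ?E (at x) = - c * ?E x" for x
    by (intro vector_derivative_at has_vector_derivative_exp_cmult)
  have E: "continuous_on A ?E" for A by (intro continuous_intros)
  have i: "set_integrable lborel {0<..<l} (\<lambda>x. c * y x + p x * u x)"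
    using p y u by (intro set_integral_add set_integrable_continuous L2_integrable L2_mult_continuous continuous_intros)
  have "is_weak_deriv l (\<lambda>x. y x * ?E x) (\<lambda>x. (c * y x + p x * u x) * ?E x + y x * (- c * ?E x))"
    using is_weak_deriv_mult_smooth[OF y i wd smooth_exp[of "- c"]] unfolding E' .
  then have "is_weak_deriv l (\<lambda>x. y x * ?E x) (\<lambda>x. p x * (u x * ?E x))"
    by (simp add: algebra_simps)
  then have I: "(LINT s:{0<..<x}|lborel. p s * (u s * ?E s)) = y x * ?E x - y 0 * ?E 0"
    using p y u E x by (intro weak_deriv_integral L2_integrable L2_mult_continuous continuous_intros) auto
  have E_inv: "exp (c * of_real x) * ?E x = 1"
    by (simp add: exp_minus)
  have "exp (c * of_real x) * (LINT s:{0<..<x}|lborel. p s * (u s * ?E s))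
      = y x * (exp (c * of_real x) * ?E x) - y 0 * exp (c * of_real x)"
    unfolding I by (simp add: right_diff_distrib mult_ac)
  then have "exp (c * of_real x) * (LINT s:{0<..<x}|lborel. p s * (u s * ?E s)) = y x - y 0 * exp (c * of_real x)"
    unfolding E_inv by simp
  moreover have "exp (c * of_real x) * (LINT s:{0<..<x}|lborel. p s * (u s * ?E s)) = volterra p c u x"
    unfolding volterra_def set_integral_mult_right[symmetric]
    by (simp add: right_diff_distrib exp_diff exp_minus divide_inverse mult_ac)
  ultimately have "y x - y 0 * exp (c * of_real x) = volterra p c u x" by (simp only:)
  then show ?thesis by (simp add: diff_eq_eq add.commute)
qed

lemma e_solution_volterra:
  assumes f: "f \<in> W12 l" "\<forall>x\<in>{0..l}. f x \<noteq> 0" and e: "is_e_solution l f \<rho> y" and "\<rho> \<noteq> 0"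
    and p: "\<And>x. x \<in> {0<..<l} \<Longrightarrow> p x = wderiv l f x / f x"
  obtains a b where "continuous_on {0..l} a" "continuous_on {0..l} b" "\<And>x. y x = a x + b x"
    "\<And>x. x \<in> {0..l} \<Longrightarrow> a x = exp (\<i> * \<rho> * of_real x) + volterra p (\<i> * \<rho>) b x"
    "\<And>x. x \<in> {0..l} \<Longrightarrow> b x = volterra p (- \<i> * \<rho>) a x"
proof -
  obtain v where y: "continuous_on {0..l} y" and v: "continuous_on {0..l} v" and ic: "y 0 = 1" "v 0 = \<i> * \<rho>"
    and pL2: "p \<in> L2 {0<..<l}" and wd_y: "is_weak_deriv l y (\<lambda>x. p x * y x + v x)"
    and wd_v: "is_weak_deriv l v (\<lambda>x. - (p x * v x + \<rho>\<^sup>2 * y x))"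
    using e_solution_system[OF f e p] by blast
  text \<open>The combinations of \<open>y\<close> and \<open>v / (\<i> \<rho>)\<close> that diagonalize the system for \<open>p = 0\<close>.\<close>
  define \<kappa> where "\<kappa> = 1 / (2 * \<i> * \<rho>)"
  define a where "a x = 1 / 2 * y x + \<kappa> * v x" for x
  define b where "b x = 1 / 2 * y x + (- \<kappa>) * v x" for x
  have cont: "continuous_on {0..l} a" "continuous_on {0..l} b"
    unfolding a_def b_def by (intro continuous_intros y v)+
  have i: "set_integrable lborel {0<..<l} (\<lambda>x. p x * y x + v x)"
    by (rule set_integral_add(1)[OF L2_integrable[OF L2_mult_continuous[OF pL2 y]] set_integrable_continuous[OF v]])
  have "set_integrable lborel {0<..<l} (\<lambda>x. p x * v x + \<rho>\<^sup>2 * y x)"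
    by (rule set_integral_add(1)[OF L2_integrable[OF L2_mult_continuous[OF pL2 v]] set_integrable_continuous])
      (intro continuous_intros y)
  then have i2: "set_integrable lborel {0<..<l} (\<lambda>x. - (p x * v x + \<rho>\<^sup>2 * y x))"
    by (simp only: set_integrable_def scaleR_minus_right integrable_minus)
  \<comment> \<open>One identity covers both equations: it is used with (k, c) = (\<kappa>, \<i>
    \<rho>) for \<open>a\<close> and with both signs reversed for \<open>b\<close>.\<close>
  have eq: "1 / 2 * (P * Y + V) + k * - (P * V + \<rho>\<^sup>2 * Y) = c * (1 / 2 * Y + k * V) + P * (1 / 2 * Y + - k * V)"
    if h: "k * \<rho> * \<rho> = - (c / 2)" "c * k = 1 / 2" for k c P Y V :: complex
  proof -
    have "1 / 2 * (P * Y + V) + k * - (P * V + \<rho>\<^sup>2 * Y) = 1 / 2 * (P * Y + V) - k * P * V - (k * \<rho> * \<rho>) * Y"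
      by (simp add: algebra_simps power2_eq_square)
    also have "\<dots> = c * Y / 2 + 1 / 2 * V + P * Y / 2 - k * P * V"
      unfolding h(1) by (simp add: algebra_simps add_divide_distrib)
    also have "\<dots> = c * (1 / 2 * Y) + (c * k) * V + P * (1 / 2 * Y + - k * V)"
      unfolding h(2) by (simp add: algebra_simps)
    finally show ?thesis by (simp only: distrib_left mult.assoc)
  qed
  have \<kappa>: "\<kappa> * \<rho> * \<rho> = - (\<i> * \<rho> / 2)" "\<i> * \<rho> * \<kappa> = 1 / 2"
    unfolding \<kappa>_def using \<open>\<rho> \<noteq> 0\<close> by (simp_all add: divide_simps)
  have eq_a: "1 / 2 * (P * Y + V) + \<kappa> * - (P * V + \<rho>\<^sup>2 * Y) = \<i> * \<rho> * (1 / 2 * Y + \<kappa> * V) + P * (1 / 2 * Y + - \<kappa> * V)" for P Y V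
    by (rule eq[OF \<kappa>])
  have eq_b: "1 / 2 * (P * Y + V) + - \<kappa> * - (P * V + \<rho>\<^sup>2 * Y) = - \<i> * \<rho> * (1 / 2 * Y + - \<kappa> * V) + P * (1 / 2 * Y + \<kappa> * V)" for P Y V
    using eq[of "- \<kappa>" "- \<i> * \<rho>" P Y V] \<kappa> by simp
  have wd_a: "is_weak_deriv l a (\<lambda>x. \<i> * \<rho> * a x + p x * b x)"
    unfolding a_def[abs_def] b_def[abs_def]
    using is_weak_deriv_lincomb[OF y i wd_y v i2 wd_v, of "1 / 2" \<kappa>] unfolding eq_a .
  have wd_b: "is_weak_deriv l b (\<lambda>x. - \<i> * \<rho> * b x + p x * a x)"
    unfolding a_def[abs_def] b_def[abs_def]
    using is_weak_deriv_lincomb[OF y i wd_y v i2 wd_v, of "1 / 2" "- \<kappa>"] unfolding eq_b .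
  have \<kappa>': "\<kappa> * (\<i> * \<rho>) = 1 / 2"
    by (subst mult.commute) (rule \<kappa>(2))
  have ab0: "a 0 = 1" "b 0 = 0"
    unfolding a_def b_def ic mult_minus_left \<kappa>' by simp_all
  have yab: "y x = a x + b x" for x
    unfolding a_def b_def by (simp add: field_simps)
  show thesis
  proof (rule that[OF cont yab])
    show "a x = exp (\<i> * \<rho> * of_real x) + volterra p (\<i> * \<rho>) b x" if "x \<in> {0..l}" for x
      using variation_of_constants[OF cont(1,2) pL2 wd_a that] unfolding ab0 by (simp only: mult_1)
    show "b x = volterra p (- \<i> * \<rho>) a x" if "x \<in> {0..l}" for x
      using variation_of_constants[OF cont(2,1) pL2 wd_b that] unfolding ab0 by (simp only: mult_zero_left add_0)
  qed
qed

text \<open>At \<rho> = 0 the system is triangular: the equation for \<open>v\<close> is closed. The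
  equation for \<open>y\<close> is stated under the condition that \<open>v\<close> vanishes,
  because that fact rests on the iteration estimates, which come later.\<close>

lemma e_solution_volterra_0:
  assumes f: "f \<in> W12 l" "\<forall>x\<in>{0..l}. f x \<noteq> 0" and e: "is_e_solution l f 0 y"
    and p: "\<And>x. x \<in> {0<..<l} \<Longrightarrow> p x = wderiv l f x / f x"
  obtains v where "continuous_on {0..l} y" "continuous_on {0..l} v"
    "\<And>x. x \<in> {0..l} \<Longrightarrow> v x = volterra p 0 (\<lambda>x. - v x) x"
    "\<And>x. (\<And>s. s \<in> {0..l} \<Longrightarrow> v s = 0) \<Longrightarrow> x \<in> {0..l} \<Longrightarrow> y x = 1 + volterra p 0 y x"
proof -
  obtain v where y: "continuous_on {0..l} y" and v: "continuous_on {0..l} v" and ic: "y 0 = 1" "v 0 = 0"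
    and pL2: "p \<in> L2 {0<..<l}" and wd_y: "is_weak_deriv l y (\<lambda>x. p x * y x + v x)"
    and wd_v: "is_weak_deriv l v (\<lambda>x. - (p x * v x))"
    using e_solution_system[OF f e p] by auto
  show thesis
  proof (rule that[OF y v])
    have "is_weak_deriv l v (\<lambda>x. 0 * v x + p x * - v x)"
      using wd_v by simp
    from variation_of_constants[OF v continuous_on_minus[OF v] pL2 this]
    show "v x = volterra p 0 (\<lambda>x. - v x) x" if "x \<in> {0..l}" for x
      using that by (simp add: ic)
    show "y x = 1 + volterra p 0 y x" if v0: "\<And>x. x \<in> {0..l} \<Longrightarrow> v x = 0" and x: "x \<in> {0..l}" for x
    proof -
      have i_py: "set_integrable lborel {0<..<l} (\<lambda>x. p x * y x)"
        by (rule L2_integrable[OF L2_mult_continuous[OF pL2 y]])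
      have "is_weak_deriv l y (\<lambda>x. p x * y x)"
        by (rule is_weak_deriv_cong_AE[OF wd_y set_integral_add(1)[OF i_py set_integrable_continuous[OF v]] i_py])
          (use v0 in auto)
      then have "is_weak_deriv l y (\<lambda>x. 0 * y x + p x * y x)" by simp
      from variation_of_constants[OF y y pL2 this x] show ?thesis by (simp add: ic)
    qed
  qed
qed

subsection \<open>The Neumann series\<close>

text \<open>A function that is not integrable has Bochner integral 0 by convention, so the bound
  holds in that case too.\<close>

lemma ennreal_norm_integral_le:
  fixes u :: "'a \<Rightarrow> complex"
  shows "ennreal (norm (integral\<^sup>L M u)) \<le> (\<integral>\<^sup>+x. ennreal (norm (u x)) \<partial>M)"
  using integral_norm_bound_ennreal[of M u] by (cases "integrable M u") (auto simp: not_integrable_integral_eq)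

text \<open>The Gronwall-type induction behind every estimate: it is applied to the squared iterates
  at a point and to the squared norms of the kernels. Values in \<open>ennreal\<close> allow its use
  before anything is known to be finite.\<close>

lemma iterated_integral_bound:
  fixes u :: "nat \<Rightarrow> real \<Rightarrow> ennreal"
  assumes base: "\<And>x. x \<in> {0..l} \<Longrightarrow> u 0 x \<le> ennreal M"
    and step: "\<And>n x. x \<in> {0..l} \<Longrightarrow> u (Suc n) x \<le> ennreal C * (\<integral>\<^sup>+s. u n s * indicator {0..x} s \<partial>lborel)"
    and nonneg: "0 \<le> M" "0 \<le> C" and x: "x \<in> {0..l}"
  shows "u n x \<le> ennreal (M * (C * x) ^ n / fact n)"
  using x
proof (induction n arbitrary: x)
  case (Suc n)
  have "(\<integral>\<^sup>+s. u n s * indicator {0..x} s \<partial>lborel)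
      \<le> (\<integral>\<^sup>+s. ennreal (M * (C * s) ^ n / fact n) * indicator {0..x} s \<partial>lborel)"
    using Suc by (intro nn_integral_mono) (auto simp: indicator_def)
  also have "\<dots> = ennreal (M * C ^ n * x ^ Suc n / fact (Suc n) - M * C ^ n * 0 ^ Suc n / fact (Suc n))"
  proof (rule nn_integral_FTC_Icc)
    show "((\<lambda>x. M * C ^ n * x ^ Suc n / fact (Suc n)) has_real_derivative M * (C * s) ^ n / fact n) (at s)" for s
      by (rule derivative_eq_intros refl | simp add: power_mult_distrib)+
  qed (use Suc.prems nonneg in auto)
  finally have "u (Suc n) x \<le> ennreal C * ennreal (M * C ^ n * x ^ Suc n / fact (Suc n))"
    using order_trans[OF step[OF Suc.prems] mult_left_mono] by simp
  also have "\<dots> = ennreal (M * (C * x) ^ Suc n / fact (Suc n))"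
    using nonneg Suc.prems by (subst ennreal_mult[symmetric]) (auto simp: power_mult_distrib mult_ac)
  finally show ?case .
qed (use base in auto)

text \<open>The potential is extended by zero to a Borel function on the line, so that integrals
  involving it can be taken over all of \<open>lborel\<close>.\<close>

locale l2_potential =
  fixes l :: real and p :: "real \<Rightarrow> complex"
  assumes p_measurable [measurable]: "p \<in> borel_measurable borel"
    and p_outside: "x \<notin> {0<..<l} \<Longrightarrow> p x = 0"
    and p_square_integrable: "integrable lborel (\<lambda>x. (norm (p x))\<^sup>2)"
begin

definition D :: real where "D = (LINT x|lborel. (norm (p x))\<^sup>2)"

lemma D_nonneg: "0 \<le> D"
  by (simp add: D_def)

lemma nn_integral_p_square: "(\<integral>\<^sup>+x. (ennreal (norm (p x)))\<^sup>2 \<partial>lborel) = ennreal D"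
  using nn_integral_eq_integral[OF p_square_integrable] by (simp add: D_def ennreal_power)

lemma integrable_p_mult:
  assumes [measurable]: "u \<in> borel_measurable borel" and u: "\<And>x. x \<in> {0<..<l} \<Longrightarrow> norm (u x) \<le> B"
  shows "integrable lborel (\<lambda>s. p s * u s)"
proof (rule Bochner_Integration.integrable_bound)
  show "integrable lborel (\<lambda>x. \<bar>B\<bar> * ((norm (p x))\<^sup>2 + indicat_real {0<..<l} x))"
    using p_square_integrable by (cases "0 \<le> l") auto
  show "AE x in lborel. norm (p x * u x) \<le> norm (\<bar>B\<bar> * ((norm (p x))\<^sup>2 + indicat_real {0<..<l} x))"
  proof (intro always_eventually allI)
    fix x
    show "norm (p x * u x) \<le> norm (\<bar>B\<bar> * ((norm (p x))\<^sup>2 + indicat_real {0<..<l} x))"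
    proof (cases "x \<in> {0<..<l}")
      case True
      have "0 \<le> (norm (p x) - 1)\<^sup>2" by simp
      then have "norm (p x) \<le> (norm (p x))\<^sup>2 + 1"
        using norm_ge_zero[of "p x"] unfolding power2_diff one_power2 by linarith
      then have "norm (p x) * norm (u x) \<le> ((norm (p x))\<^sup>2 + 1) * \<bar>B\<bar>"
        using u[OF True] by (intro mult_mono) auto
      then show ?thesis using True by (simp add: norm_mult abs_mult mult.commute)
    qed (simp add: p_outside)
  qed
qed measurable

text \<open>Cauchy-Schwarz with \<open>p\<close> put entirely into the constant \<open>D\<close>.
  Squaring the left side yields exactly the recursion that \<open>iterated_integral_bound\<close>
  expects.\<close>

lemma integral_p_mult_square_le:
  assumes [measurable]: "u \<in> borel_measurable borel"
  shows "ennreal ((norm (LINT s:{0<..<x}|lborel. p s * u s))\<^sup>2)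
    \<le> ennreal D * (\<integral>\<^sup>+s. ennreal ((norm (u s))\<^sup>2) * indicator {0..x} s \<partial>lborel)"
proof -
  have "ennreal (norm (LINT s:{0<..<x}|lborel. p s * u s))
    \<le> (\<integral>\<^sup>+s. ennreal (norm (indicator {0<..<x} s *\<^sub>R (p s * u s))) \<partial>lborel)"
    unfolding set_lebesgue_integral_def by (rule ennreal_norm_integral_le)
  also have "\<dots> \<le> (\<integral>\<^sup>+s. ennreal (norm (p s)) * (ennreal (norm (u s)) * indicator {0..x} s) \<partial>lborel)"
    by (intro nn_integral_mono) (auto simp: indicator_def norm_mult ennreal_mult)
  finally have "(ennreal (norm (LINT s:{0<..<x}|lborel. p s * u s)))\<^sup>2
    \<le> (\<integral>\<^sup>+s. ennreal (norm (p s)) * (ennreal (norm (u s)) * indicator {0..x} s) \<partial>lborel)\<^sup>2"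
    by (intro power_mono) auto
  also have "\<dots> \<le> (\<integral>\<^sup>+s. (ennreal (norm (p s)))\<^sup>2 \<partial>lborel) * (\<integral>\<^sup>+s. (ennreal (norm (u s)) * indicator {0..x} s)\<^sup>2 \<partial>lborel)"
    by (rule Cauchy_Schwarz_nn_integral) measurable
  also have "(\<integral>\<^sup>+s. (ennreal (norm (u s)) * indicator {0..x} s)\<^sup>2 \<partial>lborel)
    = (\<integral>\<^sup>+s. ennreal ((norm (u s))\<^sup>2) * indicator {0..x} s \<partial>lborel)"
    by (intro nn_integral_cong) (auto simp: indicator_def ennreal_power)
  finally show ?thesis
    unfolding nn_integral_p_square by (simp add: ennreal_power)
qed

lemma measurable_volterra:
  assumes [measurable]: "u \<in> borel_measurable borel"
  shows "volterra p c u \<in> borel_measurable borel"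
proof -
  \<comment> \<open>The moving domain of integration is moved into the integrand, which is then
    jointly measurable in x and s.\<close>
  have "(\<lambda>x. LINT s|lborel. (if 0 < s \<and> s < x then p s * exp (c * of_real (x - s)) * u s else 0)) \<in> borel_measurable borel"
    by (rule sigma_finite_measure.borel_measurable_lebesgue_integral[OF sigma_finite_lborel]) measurable
  also have "(\<lambda>x. LINT s|lborel. (if 0 < s \<and> s < x then p s * exp (c * of_real (x - s)) * u s else 0)) = volterra p c u"
    unfolding volterra_def set_lebesgue_integral_def
    by (intro ext Bochner_Integration.integral_cong) (auto simp: indicator_def)
  finally show ?thesis .
qed

lemma volterra_cong:
  assumes "\<And>s. s \<in> {0..l} \<Longrightarrow> u s = w s" "x \<in> {0..l}"
  shows "volterra p c u x = volterra p c w x"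
  unfolding volterra_def using assms by (intro set_lebesgue_integral_cong) auto

lemma norm_exp_le:
  assumes "\<bar>t\<bar> \<le> l"
  shows "norm (exp (c * complex_of_real t)) \<le> exp (norm c * l)"
proof -
  have "norm (exp (c * complex_of_real t)) \<le> exp (norm (c * complex_of_real t))"
    by (rule norm_exp)
  also have "\<dots> \<le> exp (norm c * l)"
    using assms by (simp add: norm_mult mult_left_mono)
  finally show ?thesis .
qed

lemma volterra_add:
  assumes [measurable]: "u \<in> borel_measurable borel" "w \<in> borel_measurable borel"
    and bound: "\<And>s. s \<in> {0..l} \<Longrightarrow> norm (u s) \<le> B" "\<And>s. s \<in> {0..l} \<Longrightarrow> norm (w s) \<le> B'"
    and x: "x \<in> {0..l}"
  shows "volterra p c (\<lambda>s. u s + w s) x = volterra p c u x + volterra p c w x"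
proof -
  have i: "set_integrable lborel {0<..<x} (\<lambda>s. p s * exp (c * of_real (x - s)) * u s)"
    if [measurable]: "u \<in> borel_measurable borel" and b: "\<And>s. s \<in> {0..l} \<Longrightarrow> norm (u s) \<le> B" for u B
  proof -
    have "norm (exp (c * of_real (x - s)) * u s) \<le> exp (norm c * l) * B" if "s \<in> {0<..<l}" for s
      unfolding norm_mult using x that b[of s] by (intro mult_mono norm_exp_le) auto
    then have "integrable lborel (\<lambda>s. p s * (exp (c * of_real (x - s)) * u s))"
      by (intro integrable_p_mult) auto
    then have "integrable lborel (\<lambda>s. indicator {0<..<x} s *\<^sub>R (p s * (exp (c * of_real (x - s)) * u s)))"
      by (intro integrable_mult_indicator) auto
    then show ?thesis by (simp add: set_integrable_def mult.assoc)
  qed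
  show ?thesis
    unfolding volterra_def using set_integral_add(2)[OF i[of u B] i[of w B']] bound
    by (simp add: distrib_left)
qed

text \<open>
  The two Volterra equations for \<open>a\<close> and \<open>b\<close> are alternated, so the sign of the phase depends on the
  parity of the step: \<open>iter\<close> applied to \<open>a\<close> gives \<open>a, b, a - exp (\<i> \<rho> x), \<dots>\<close>.
\<close>

definition phase :: "complex \<Rightarrow> nat \<Rightarrow> complex" where
  "phase \<rho> n = - (\<i> * \<rho>) * (- 1) ^ n"

primrec iter :: "complex \<Rightarrow> (real \<Rightarrow> complex) \<Rightarrow> nat \<Rightarrow> real \<Rightarrow> complex" where
  "iter \<rho> u 0 = u"
| "iter \<rho> u (Suc n) = volterra p (phase \<rho> n) (iter \<rho> u n)"

lemma measurable_iter: "u \<in> borel_measurable borel \<Longrightarrow> iter \<rho> u n \<in> borel_measurable borel"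
  by (induction n) (auto intro: measurable_volterra)

lemma norm_phase: "norm (phase \<rho> n) = norm \<rho>"
  by (simp add: phase_def norm_mult norm_power)

text \<open>Each exponential factor has modulus at most exp(|\<rho>| l), so a step multiplies the
  constant \<open>D\<close> by the square of this number.\<close>

lemma iter_bound:
  assumes u: "u \<in> borel_measurable borel" and B: "\<And>x. x \<in> {0..l} \<Longrightarrow> norm (u x) \<le> B" and x: "x \<in> {0..l}"
  shows "(norm (iter \<rho> u n x))\<^sup>2 \<le> B\<^sup>2 * (D * (exp (norm \<rho> * l))\<^sup>2 * x) ^ n / fact n"
proof -
  let ?E = "exp (norm \<rho> * l)"
  have "ennreal ((norm (iter \<rho> u n x))\<^sup>2) \<le> ennreal (B\<^sup>2 * (D * ?E\<^sup>2 * x) ^ n / fact n)"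
  proof (rule iterated_integral_bound[OF _ _ _ _ x])
    show "ennreal ((norm (iter \<rho> u 0 x))\<^sup>2) \<le> ennreal (B\<^sup>2)" if "x \<in> {0..l}" for x
      using B[OF that] by (auto intro!: ennreal_leI power_mono)
    fix n x assume x: "x \<in> {0..l}"
    have [measurable]: "iter \<rho> u n \<in> borel_measurable borel" by (rule measurable_iter[OF u])
    let ?w = "\<lambda>s. exp (phase \<rho> n * of_real (x - s)) * iter \<rho> u n s"
    have "ennreal ((norm (iter \<rho> u (Suc n) x))\<^sup>2) \<le> ennreal D * (\<integral>\<^sup>+s. ennreal ((norm (?w s))\<^sup>2) * indicator {0..x} s \<partial>lborel)"
      using integral_p_mult_square_le[of ?w x] by (simp add: volterra_def mult.assoc)
    also have "\<dots> \<le> ennreal D * (\<integral>\<^sup>+s. ennreal (?E\<^sup>2) * (ennreal ((norm (iter \<rho> u n s))\<^sup>2) * indicator {0..x} s) \<partial>lborel)"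
    proof (intro mult_left_mono nn_integral_mono)
      fix s
      have "norm (exp (phase \<rho> n * of_real (x - s))) \<le> ?E" if "s \<in> {0..x}"
        using norm_exp_le[of "x - s" "phase \<rho> n"] x that by (simp add: norm_phase)
      then have "(norm (?w s))\<^sup>2 \<le> ?E\<^sup>2 * (norm (iter \<rho> u n s))\<^sup>2" if "s \<in> {0..x}"
        using that by (auto simp: norm_mult power_mult_distrib intro!: mult_right_mono power_mono)
      then show "ennreal ((norm (?w s))\<^sup>2) * indicator {0..x} s \<le> ennreal (?E\<^sup>2) * (ennreal ((norm (iter \<rho> u n s))\<^sup>2) * indicator {0..x} s)"
        by (auto simp: indicator_def ennreal_mult[symmetric] intro!: ennreal_leI)
    qed auto
    also have "\<dots> = ennreal (D * ?E\<^sup>2) * (\<integral>\<^sup>+s. ennreal ((norm (iter \<rho> u n s))\<^sup>2) * indicator {0..x} s \<partial>lborel)"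
      using D_nonneg by (subst nn_integral_cmult) (auto simp: ennreal_mult mult.assoc)
    finally show "ennreal ((norm (iter \<rho> u (Suc n) x))\<^sup>2) \<le> \<dots>" .
  qed (use D_nonneg in auto)
  then show ?thesis
    using D_nonneg x by (subst (asm) ennreal_le_iff) auto
qed

lemma iter_bounded:
  assumes u: "u \<in> borel_measurable borel" and B: "\<And>x. x \<in> {0..l} \<Longrightarrow> norm (u x) \<le> B"
  obtains B' where "\<And>x. x \<in> {0..l} \<Longrightarrow> norm (iter \<rho> u n x) \<le> B'"
proof -
  let ?R = "B\<^sup>2 * (D * (exp (norm \<rho> * l))\<^sup>2 * l) ^ n / fact n"
  have "norm (iter \<rho> u n x) \<le> sqrt ?R" if x: "x \<in> {0..l}" for x
  proof (rule real_le_rsqrt)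
    have "(norm (iter \<rho> u n x))\<^sup>2 \<le> B\<^sup>2 * (D * (exp (norm \<rho> * l))\<^sup>2 * x) ^ n / fact n"
      by (rule iter_bound[OF u B x])
    also have "\<dots> \<le> ?R"
      using x D_nonneg by (intro divide_right_mono mult_left_mono power_mono mult_nonneg_nonneg) auto
    finally show "(norm (iter \<rho> u n x))\<^sup>2 \<le> ?R" .
  qed
  then show thesis by (rule that)
qed

lemma iter_tendsto_0:
  assumes u: "u \<in> borel_measurable borel" and B: "\<And>x. x \<in> {0..l} \<Longrightarrow> norm (u x) \<le> B" and x: "x \<in> {0..l}"
  shows "(\<lambda>n. iter \<rho> u n x) \<longlonglongrightarrow> 0"
proof -
  let ?z = "D * (exp (norm \<rho> * l))\<^sup>2 * x"
  have "(\<lambda>n. B\<^sup>2 * (inverse (fact n) * ?z ^ n)) \<longlonglongrightarrow> B\<^sup>2 * 0"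
    by (intro tendsto_mult tendsto_const summable_LIMSEQ_zero summable_exp)
  then have "(\<lambda>n. B\<^sup>2 * ?z ^ n / fact n) \<longlonglongrightarrow> 0"
    by (simp add: divide_inverse mult_ac)
  then have "(\<lambda>n. (norm (iter \<rho> u n x))\<^sup>2) \<longlonglongrightarrow> 0"
    by (rule Lim_null_comparison[rotated]) (use iter_bound[OF u B x] in auto)
  from tendsto_real_sqrt[OF this] show ?thesis
    by (simp add: tendsto_norm_zero_iff)
qed

lemma exp_measurable_bounded:
  fixes c :: complex and x :: real
  shows "(\<lambda>x. exp (c * complex_of_real x)) \<in> borel_measurable borel"
  "x \<in> {0..l} \<Longrightarrow> norm (exp (c * complex_of_real x)) \<le> exp (norm c * l)"
  by (simp, rule norm_exp_le, simp)

lemma iter_exp_sums: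
  assumes a: "continuous_on {0..l} a" and b: "continuous_on {0..l} b"
    and ab: "\<And>x. x \<in> {0..l} \<Longrightarrow> a x = exp (\<i> * \<rho> * of_real x) + volterra p (\<i> * \<rho>) b x"
      "\<And>x. x \<in> {0..l} \<Longrightarrow> b x = volterra p (- \<i> * \<rho>) a x"
    and x: "x \<in> {0..l}"
  shows "(\<lambda>n. iter \<rho> (\<lambda>x. exp (\<i> * \<rho> * of_real x)) n x) sums (a x + b x)"
proof -
  let ?g = "\<lambda>x. exp (\<i> * \<rho> * complex_of_real x)"
  define u where "u x = indicator {0..l} x *\<^sub>R a x" for x
  have u: "u \<in> borel_measurable borel"
    unfolding u_def using borel_measurable_continuous_on_indicator[OF _ a] by simp
  obtain B where B: "\<And>x. x \<in> {0..l} \<Longrightarrow> norm (u x) \<le> B"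
    using compact_imp_bounded[OF compact_continuous_image[OF a compact_Icc]]
    unfolding bounded_iff by (auto simp: u_def simp del: atLeastAtMost_iff)
  have u_eq: "u x = a x" if "x \<in> {0..l}" for x using that by (simp add: u_def)
  note g = exp_measurable_bounded[where c = "\<i> * \<rho>"]
  \<comment> \<open>Two Volterra steps lead from \<open>a\<close> back to \<open>a\<close> minus the
    free exponential. Since \<open>phase\<close> has period 2 in \<open>n\<close>, applying the same
    further steps to all three terms propagates the relation.\<close>
  have rec: "iter \<rho> u n x = iter \<rho> ?g n x + iter \<rho> u (n + 2) x" if "x \<in> {0..l}" for n x
    using that
  proof (induction n arbitrary: x)
    case 0
    have 1: "iter \<rho> u (Suc 0) s = b s" if "s \<in> {0..l}" for s
      using volterra_cong[OF u_eq that] ab(2)[OF that] by (simp add: phase_def)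
    have "volterra p (\<i> * \<rho>) (iter \<rho> u (Suc 0)) x = volterra p (\<i> * \<rho>) b x"
      by (rule volterra_cong[OF 1 0])
    then have "iter \<rho> u 2 x = volterra p (\<i> * \<rho>) b x"
      by (simp add: phase_def numeral_2_eq_2)
    moreover have "iter \<rho> u 0 x = a x" using u_eq[OF 0] by simp
    ultimately show ?case unfolding add_0 using ab(1)[OF 0] by (simp only: iter.simps(1))
  next
    case (Suc n)
    obtain B1 where B1: "\<And>x. x \<in> {0..l} \<Longrightarrow> norm (iter \<rho> ?g n x) \<le> B1" using iter_bounded[OF g] by blast
    obtain B2 where B2: "\<And>x. x \<in> {0..l} \<Longrightarrow> norm (iter \<rho> u (n + 2) x) \<le> B2" using iter_bounded[OF u B] by blast
    have "iter \<rho> u (Suc n) x = volterra p (phase \<rho> n) (\<lambda>s. iter \<rho> ?g n s + iter \<rho> u (n + 2) s) x"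
      unfolding iter.simps by (rule volterra_cong[OF Suc])
    also have "\<dots> = volterra p (phase \<rho> n) (iter \<rho> ?g n) x + volterra p (phase \<rho> n) (iter \<rho> u (n + 2)) x"
      by (rule volterra_add[OF measurable_iter[OF g(1)] measurable_iter[OF u] B1 B2 Suc.prems])
    also have "phase \<rho> n = phase \<rho> (n + 2)" by (simp add: phase_def)
    finally show ?case by (simp add: phase_def)
  qed
  \<comment> \<open>The index in \<open>rec\<close> jumps by 2, so telescoping leaves two initial
    terms, which are \<open>a\<close> and \<open>b\<close>, and two remainders, which tend to
    0.\<close>
  have "(\<Sum>n<N. iter \<rho> ?g n x) = iter \<rho> u 0 x + iter \<rho> u 1 x - (iter \<rho> u N x + iter \<rho> u (Suc N) x)" for N
    using rec[OF x] by (induction N) (auto simp: algebra_simps)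
  moreover have "(\<lambda>N. iter \<rho> u 0 x + iter \<rho> u 1 x - (iter \<rho> u N x + iter \<rho> u (Suc N) x))
      \<longlonglongrightarrow> iter \<rho> u 0 x + iter \<rho> u 1 x - (0 + 0)"
    by (intro tendsto_intros iter_tendsto_0[OF u B x] LIMSEQ_Suc[OF iter_tendsto_0[OF u B x]])
  moreover have "iter \<rho> u 0 x + iter \<rho> u 1 x = a x + b x"
    using volterra_cong[OF u_eq x] ab(2)[OF x] u_eq[OF x] by (simp add: phase_def)
  ultimately show ?thesis unfolding sums_def by simp
qed

text \<open>Iterating the equation reproduces \<open>v\<close> up to sign, while iterates of a
  bounded function tend to 0.\<close>

lemma volterra_fixed_point_0:
  assumes v: "continuous_on {0..l} v" and fp: "\<And>x. x \<in> {0..l} \<Longrightarrow> v x = volterra p 0 (\<lambda>x. - v x) x"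
    and x: "x \<in> {0..l}"
  shows "v x = 0"
proof -
  define u where "u x = indicator {0..l} x *\<^sub>R v x" for x
  have u: "u \<in> borel_measurable borel"
    unfolding u_def using borel_measurable_continuous_on_indicator[OF _ v] by simp
  obtain B where B: "\<And>x. x \<in> {0..l} \<Longrightarrow> norm (u x) \<le> B"
    using compact_imp_bounded[OF compact_continuous_image[OF v compact_Icc]]
    unfolding bounded_iff by (auto simp: u_def simp del: atLeastAtMost_iff)
  have eq: "iter 0 u n x = (- 1) ^ n * v x" if "x \<in> {0..l}" for n x
    using that
  proof (induction n arbitrary: x)
    case (Suc n)
    have "iter 0 u (Suc n) x = volterra p 0 (\<lambda>s. (- 1) ^ n * v s) x"
      using volterra_cong[OF Suc] by (simp add: phase_def)
    also have "\<dots> = - ((- 1) ^ n) * volterra p 0 (\<lambda>s. - v s) x"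
      unfolding volterra_def set_integral_mult_right[symmetric] by (simp add: mult_ac)
    finally show ?case using fp[OF Suc.prems] by simp
  qed (simp add: u_def)
  have "(\<lambda>n. (- 1) ^ n * v x) \<longlonglongrightarrow> 0"
    using iter_tendsto_0[OF u B x, of 0] unfolding eq[OF x] .
  from tendsto_norm_zero[OF this]
  show ?thesis by (simp add: norm_mult norm_power LIMSEQ_const_iff)
qed

text \<open>All phases vanish at \<rho> = 0, so a single operator is iterated and the recursion
  advances by one index. The series is nevertheless the same expression in \<rho> as in the other
  case, with the exponential equal to 1.\<close>

lemma iter_exp_sums_0:
  assumes y: "continuous_on {0..l} y" and fp: "\<And>x. x \<in> {0..l} \<Longrightarrow> y x = 1 + volterra p 0 y x"
    and x: "x \<in> {0..l}"
  shows "(\<lambda>n. iter 0 (\<lambda>x. 1) n x) sums y x"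
proof -
  define u where "u x = indicator {0..l} x *\<^sub>R y x" for x
  have u: "u \<in> borel_measurable borel"
    unfolding u_def using borel_measurable_continuous_on_indicator[OF _ y] by simp
  obtain B where B: "\<And>x. x \<in> {0..l} \<Longrightarrow> norm (u x) \<le> B"
    using compact_imp_bounded[OF compact_continuous_image[OF y compact_Icc]]
    unfolding bounded_iff by (auto simp: u_def simp del: atLeastAtMost_iff)
  have u_eq: "u x = y x" if "x \<in> {0..l}" for x using that by (simp add: u_def)
  have one: "(\<lambda>x. 1 :: complex) \<in> borel_measurable borel" by simp
  have rec: "iter 0 u n x = iter 0 (\<lambda>x. 1) n x + iter 0 u (Suc n) x" if "x \<in> {0..l}" for n x
    using that
  proof (induction n arbitrary: x)
    case 0
    then show ?case
      using volterra_cong[OF u_eq 0] fp[OF 0] u_eq[OF 0] by (simp add: phase_def)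
  next
    case (Suc n)
    obtain B1 where B1: "\<And>x. x \<in> {0..l} \<Longrightarrow> norm (iter 0 (\<lambda>x. 1) n x) \<le> B1"
      using iter_bounded[OF one, of 1] by auto
    obtain B2 where B2: "\<And>x. x \<in> {0..l} \<Longrightarrow> norm (iter 0 u (Suc n) x) \<le> B2" using iter_bounded[OF u B] by blast
    have "iter 0 u (Suc n) x = volterra p 0 (\<lambda>s. iter 0 (\<lambda>x. 1) n s + iter 0 u (Suc n) s) x"
      using volterra_cong[OF Suc] by (simp add: phase_def)
    also have "\<dots> = volterra p 0 (iter 0 (\<lambda>x. 1) n) x + volterra p 0 (iter 0 u (Suc n)) x"
      by (rule volterra_add[OF measurable_iter[OF one] measurable_iter[OF u] B1 B2 Suc.prems])
    finally show ?case by (simp add: phase_def)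
  qed
  have "(\<Sum>n<N. iter 0 (\<lambda>x. 1) n x) = y x - iter 0 u N x" for N
    using rec[OF x] x by (induction N) (auto simp: algebra_simps u_def)
  moreover have "(\<lambda>N. y x - iter 0 u N x) \<longlonglongrightarrow> y x - 0"
    by (intro tendsto_intros iter_tendsto_0[OF u B x])
  ultimately show ?thesis unfolding sums_def by simp
qed

end

subsection \<open>The kernel\<close>

text \<open>Cauchy-Schwarz for the factors 2^(-n) and 2^n |k_n|. The constant 2 is a convenient
  bound for the geometric sum 4/3 of the 4^(-n).\<close>

lemma weighted_square_summable:
  fixes k :: "nat \<Rightarrow> complex"
  assumes fin: "(\<Sum>n. ennreal (4 ^ n * (norm (k n))\<^sup>2)) < \<infinity>"
  shows "summable (\<lambda>n. norm (k n))"
    and "ennreal ((norm (\<Sum>n. k n))\<^sup>2) \<le> 2 * (\<Sum>n. ennreal (4 ^ n * (norm (k n))\<^sup>2))"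
proof -
  let ?w = "\<lambda>n. 4 ^ n * (norm (k n))\<^sup>2"
  have w: "summable ?w"
    using fin by (intro summable_suminf_not_top) (auto simp: less_top)
  define S where "S = suminf ?w"
  have S: "(\<Sum>n. ennreal (?w n)) = ennreal S" "0 \<le> S"
    unfolding S_def using w by (auto intro: suminf_ennreal2 suminf_nonneg)
  have partial: "(\<Sum>n<N. norm (k n)) \<le> sqrt (2 * S)" for N
  proof (rule real_le_rsqrt)
    have "(\<Sum>n<N. norm (k n)) = (\<Sum>n<N. (1 / 2) ^ n * (2 ^ n * norm (k n)))"
      by (intro sum.cong) (auto simp: power_one_over)
    then have "(\<Sum>n<N. norm (k n))\<^sup>2 \<le> (\<Sum>n<N. ((1 / 2) ^ n)\<^sup>2) * (\<Sum>n<N. (2 ^ n * norm (k n))\<^sup>2)"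
      using Cauchy_Schwarz_ineq_sum[of "\<lambda>n. (1 / 2) ^ n" "\<lambda>n. 2 ^ n * norm (k n)" "{..<N}"] by simp
    also have "\<dots> \<le> 2 * S"
    proof (intro mult_mono)
      have "(\<Sum>n<N. ((1 / 2) ^ n)\<^sup>2) = (\<Sum>n<N. (1 / 4 :: real) ^ n)"
        by (simp add: power2_eq_square flip: power_mult_distrib)
      also have "\<dots> \<le> (\<Sum>n. (1 / 4) ^ n)"
        by (intro sum_le_suminf summable_geometric) auto
      also have "\<dots> = 4 / 3" by (subst suminf_geometric) auto
      finally show "(\<Sum>n<N. ((1 / 2) ^ n)\<^sup>2) \<le> (2 :: real)" by simp
      have "(\<Sum>n<N. (2 ^ n * norm (k n))\<^sup>2) = (\<Sum>n<N. ?w n)"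
        by (intro sum.cong) (auto simp: power_mult_distrib power2_eq_square simp flip: power_mult_distrib)
      also have "\<dots> \<le> S"
        unfolding S_def by (intro sum_le_suminf w) auto
      finally show "(\<Sum>n<N. (2 ^ n * norm (k n))\<^sup>2) \<le> S" .
    qed (auto intro: sum_nonneg)
    finally show "(\<Sum>n<N. norm (k n))\<^sup>2 \<le> 2 * S" .
  qed
  show summ: "summable (\<lambda>n. norm (k n))"
    by (rule bounded_imp_summable[where B = "sqrt (2 * S)"])
      (auto simp only: norm_ge_zero lessThan_Suc_atMost[symmetric] partial)
  have "norm (\<Sum>n. k n) \<le> (\<Sum>n. norm (k n))"
    by (rule summable_norm[OF summ])
  also have "\<dots> \<le> sqrt (2 * S)"
    by (rule suminf_le_const[OF summ partial])
  finally have "(norm (\<Sum>n. k n))\<^sup>2 \<le> 2 * S"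
    using power_mono[of _ "sqrt (2 * S)" 2] S by fastforce
  then show "ennreal ((norm (\<Sum>n. k n))\<^sup>2) \<le> 2 * (\<Sum>n. ennreal (?w n))"
    unfolding S by (metis S(2) ennreal_leI ennreal_mult ennreal_numeral zero_le_numeral)
qed

context l2_potential
begin

text \<open>
  The kernel of the \<open>(n + 1)\<close>-st Neumann term. A factor \<open>exp (\<plusminus> \<i> \<rho> (x - s))\<close> in the Volterra operator is a
  translation by \<open>\<plusminus> (x - s)\<close> on the side of the kernels, and the first term is
  \<open>\<integral> p(s) exp (\<i> \<rho> (2 s - x)) ds\<close>, where \<open>t = 2 s - x\<close>.
\<close>

primrec ker :: "nat \<Rightarrow> real \<Rightarrow> real \<Rightarrow> complex" where
  "ker 0 = (\<lambda>x t. if \<bar>t\<bar> < x then p ((x + t) / 2) / 2 else 0)"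
| "ker (Suc n) = (\<lambda>x t. LINT s:{0<..<x}|lborel. p s * ker n s (t + (- 1) ^ Suc n * (x - s)))"

text \<open>Joint measurability in both variables is proved by induction; composing with arbitrary
  measurable arguments gives a form usable as a measurability rule under the shifts in
  \<open>ker\<close>.\<close>

lemma measurable_ker:
  assumes [measurable]: "a \<in> borel_measurable M" "b \<in> borel_measurable M"
  shows "(\<lambda>w. ker n (a w) (b w)) \<in> borel_measurable M"
proof -
  have "(\<lambda>z. ker n (fst z) (snd z)) \<in> borel_measurable (borel \<Otimes>\<^sub>M borel)"
  proof (induction n)
    case 0
    show ?case by simp measurable
  next
    case (Suc n)
    have [measurable]: "(\<lambda>w. ker n (a w) (b w)) \<in> borel_measurable ((borel \<Otimes>\<^sub>M borel) \<Otimes>\<^sub>M lborel)"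
      if [measurable]: "a \<in> borel_measurable ((borel \<Otimes>\<^sub>M borel) \<Otimes>\<^sub>M lborel)" "b \<in> borel_measurable ((borel \<Otimes>\<^sub>M borel) \<Otimes>\<^sub>M lborel)" for a b
      using measurable_compose[OF _ Suc, of "\<lambda>w. (a w, b w)"] by simp
    have "(\<lambda>z::real \<times> real. LINT s|lborel. (if 0 < s \<and> s < fst z then p s * ker n s (snd z + (- 1) ^ Suc n * (fst z - s)) else 0))
        \<in> borel_measurable (borel \<Otimes>\<^sub>M borel)"
      by (rule sigma_finite_measure.borel_measurable_lebesgue_integral[OF sigma_finite_lborel]) measurable
    also have "(\<lambda>z. LINT s|lborel. (if 0 < s \<and> s < fst z then p s * ker n s (snd z + (- 1) ^ Suc n * (fst z - s)) else 0))
      = (\<lambda>z. ker (Suc n) (fst z) (snd z))"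
      unfolding ker.simps set_lebesgue_integral_def
      by (intro ext Bochner_Integration.integral_cong) (auto simp: indicator_def)
    finally show ?case .
  qed
  from measurable_compose[OF _ this, of "\<lambda>w. (a w, b w)"] show ?thesis by simp
qed

lemma abs_shift: "\<bar>(- 1 :: real) ^ n * d\<bar> = \<bar>d\<bar>"
  by (simp add: abs_mult power_abs)

text \<open>Finite propagation: the translation changes |t| by at most x - s, so a point outside the
  cone at x is sent outside the cone at s.\<close>

lemma ker_outside: "x \<le> \<bar>t\<bar> \<Longrightarrow> ker n x t = 0"
proof (induction n arbitrary: x t)
  case (Suc n)
  have "ker n s (t + (- 1) ^ Suc n * (x - s)) = 0" if "0 < s" "s < x" for s
  proof (rule Suc.IH)
    have "\<bar>t\<bar> - \<bar>(- 1) ^ Suc n * (x - s)\<bar> \<le> \<bar>t + (- 1) ^ Suc n * (x - s)\<bar>" by arith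
    then show "s \<le> \<bar>t + (- 1) ^ Suc n * (x - s)\<bar>"
      unfolding abs_shift using that Suc.prems by linarith
  qed
  then have "ker (Suc n) x t = (LINT s:{0<..<x}|lborel. 0)"
    unfolding ker.simps by (intro set_lebesgue_integral_cong) auto
  then show ?case by (simp add: set_lebesgue_integral_def)
qed auto

lemma nn_integral_shift:
  fixes c :: real
  assumes "u \<in> borel_measurable borel"
  shows "(\<integral>\<^sup>+t. u (t + c) \<partial>lborel) = (\<integral>\<^sup>+t. u t \<partial>lborel)"
  using nn_integral_real_affine[OF assms, of 1 c] by (simp add: add.commute)

text \<open>In the base case the square of the prefactor gives 1/4 and the substitution s = (x + t)
  / 2 gives 2, hence D / 2. In the step, Cauchy-Schwarz is applied in s for each t; after Tonelli,
  the translation in t is invisible to the norm.\<close>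

lemma ker_square_bound:
  assumes x: "x \<in> {0..l}"
  shows "(\<integral>\<^sup>+t. ennreal ((norm (ker n x t))\<^sup>2) \<partial>lborel) \<le> ennreal (D / 2 * (D * x) ^ n / fact n)"
proof (rule iterated_integral_bound[OF _ _ _ _ x])
  note [measurable] = measurable_ker
  fix x assume x: "x \<in> {0..l}"
  have "(\<integral>\<^sup>+t. ennreal ((norm (ker 0 x t))\<^sup>2) \<partial>lborel) \<le> (\<integral>\<^sup>+t. ennreal (1 / 4) * (ennreal (norm (p (x / 2 + (1 / 2) * t))))\<^sup>2 \<partial>lborel)"
    by (intro nn_integral_mono)
      (auto simp: norm_divide power_divide ennreal_power ennreal_mult[symmetric] add_divide_distrib)
  also have "\<dots> = ennreal (1 / 4) * (\<integral>\<^sup>+t. (ennreal (norm (p (x / 2 + (1 / 2) * t))))\<^sup>2 \<partial>lborel)"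
    by (rule nn_integral_cmult) measurable
  also have "ennreal (1 / 4) = ennreal (1 / 2) * ennreal (1 / 2)"
    by (subst ennreal_mult[symmetric]) auto
  also have "\<dots> * (\<integral>\<^sup>+t. (ennreal (norm (p (x / 2 + (1 / 2) * t))))\<^sup>2 \<partial>lborel) = ennreal (1 / 2) * ennreal D"
    unfolding mult.assoc
    using nn_integral_real_affine[of "\<lambda>s. (ennreal (norm (p s)))\<^sup>2" "1 / 2" "x / 2"] nn_integral_p_square by simp
  also have "\<dots> = ennreal (D / 2)"
    using D_nonneg by (subst ennreal_mult[symmetric]) auto
  finally show "(\<integral>\<^sup>+t. ennreal ((norm (ker 0 x t))\<^sup>2) \<partial>lborel) \<le> ennreal (D / 2)" .
next
  note [measurable] = measurable_ker
  fix n x assume x: "x \<in> {0..l}"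
  let ?d = "\<lambda>s. (- 1) ^ Suc n * (x - s) :: real"
  have "(\<integral>\<^sup>+t. ennreal ((norm (ker (Suc n) x t))\<^sup>2) \<partial>lborel)
    \<le> (\<integral>\<^sup>+t. ennreal D * (\<integral>\<^sup>+s. ennreal ((norm (ker n s (t + ?d s)))\<^sup>2) * indicator {0..x} s \<partial>lborel) \<partial>lborel)"
    unfolding ker.simps by (intro nn_integral_mono integral_p_mult_square_le) measurable
  also have "\<dots> = ennreal D * (\<integral>\<^sup>+t. (\<integral>\<^sup>+s. ennreal ((norm (ker n s (t + ?d s)))\<^sup>2) * indicator {0..x} s \<partial>lborel) \<partial>lborel)"
    by (rule nn_integral_cmult) measurable
  also have "(\<integral>\<^sup>+t. (\<integral>\<^sup>+s. ennreal ((norm (ker n s (t + ?d s)))\<^sup>2) * indicator {0..x} s \<partial>lborel) \<partial>lborel)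
    = (\<integral>\<^sup>+s. (\<integral>\<^sup>+t. ennreal ((norm (ker n s (t + ?d s)))\<^sup>2) * indicator {0..x} s \<partial>lborel) \<partial>lborel)"
    by (rule lborel_pair.Fubini') measurable
  also have "\<dots> = (\<integral>\<^sup>+s. (\<integral>\<^sup>+t. ennreal ((norm (ker n s t))\<^sup>2) \<partial>lborel) * indicator {0..x} s \<partial>lborel)"
  proof (intro nn_integral_cong)
    fix s
    have "(\<integral>\<^sup>+t. ennreal ((norm (ker n s (t + ?d s)))\<^sup>2) \<partial>lborel) = (\<integral>\<^sup>+t. ennreal ((norm (ker n s t))\<^sup>2) \<partial>lborel)"
      by (rule nn_integral_shift[of "\<lambda>t. ennreal ((norm (ker n s t))\<^sup>2)"]) measurable
    moreover have "(\<lambda>t. ennreal ((norm (ker n s (t + ?d s)))\<^sup>2)) \<in> borel_measurable lborel"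
      by measurable
    ultimately show "(\<integral>\<^sup>+t. ennreal ((norm (ker n s (t + ?d s)))\<^sup>2) * indicator {0..x} s \<partial>lborel)
      = (\<integral>\<^sup>+t. ennreal ((norm (ker n s t))\<^sup>2) \<partial>lborel) * indicator {0..x} s"
      by (simp only: nn_integral_multc)
  qed
  finally show "(\<integral>\<^sup>+t. ennreal ((norm (ker (Suc n) x t))\<^sup>2) \<partial>lborel)
    \<le> ennreal D * (\<integral>\<^sup>+s. (\<integral>\<^sup>+t. ennreal ((norm (ker n s t))\<^sup>2) \<partial>lborel) * indicator {0..x} s \<partial>lborel)" .
qed (use D_nonneg in auto)

text \<open>From 2 |k| \<le> w |k|^2 + 1 / w. The weight \<open>w\<close> stays free: w = 1 gives
  integrability of one term, and w = 2^n later makes both parts of the bound summable over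
  n.\<close>

lemma ker_exp_nn_integral:
  assumes x: "x \<in> {0..l}" and w: "0 < w"
  shows "(\<integral>\<^sup>+t. ennreal (norm (ker n x t * exp (\<i> * \<rho> * of_real t))) \<partial>lborel)
    \<le> ennreal (exp (norm \<rho> * l) * (w * (D / 2 * (D * l) ^ n / fact n) + 2 * l / w))"
proof -
  note [measurable] = measurable_ker
  let ?E = "exp (norm \<rho> * l)"
  have "(\<integral>\<^sup>+t. ennreal (norm (ker n x t * exp (\<i> * \<rho> * of_real t))) \<partial>lborel)
    \<le> (\<integral>\<^sup>+t. ennreal (?E * w) * ennreal ((norm (ker n x t))\<^sup>2) + ennreal (?E / w) * indicator {-l..l} t \<partial>lborel)"
  proof (intro nn_integral_mono)
    fix t
    show "ennreal (norm (ker n x t * exp (\<i> * \<rho> * of_real t)))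
      \<le> ennreal (?E * w) * ennreal ((norm (ker n x t))\<^sup>2) + ennreal (?E / w) * indicator {-l..l} t"
    proof (cases "\<bar>t\<bar> < x")
      case True
      then have t: "\<bar>t\<bar> \<le> l" using x by auto
      have E: "norm (exp (\<i> * \<rho> * of_real t)) \<le> ?E"
        using norm_exp_le[OF t, of "\<i> * \<rho>"] by (simp add: norm_mult)
      have "0 \<le> (w * norm (ker n x t) - 1)\<^sup>2 / w" using w by simp
      then have "2 * norm (ker n x t) \<le> w * (norm (ker n x t))\<^sup>2 + 1 / w"
        using w by (simp add: power2_diff power_mult_distrib field_simps power2_eq_square)
      then have "norm (ker n x t) \<le> w * (norm (ker n x t))\<^sup>2 + 1 / w"
        using norm_ge_zero[of "ker n x t"] by linarith
      then have "norm (ker n x t * exp (\<i> * \<rho> * of_real t)) \<le> (w * (norm (ker n x t))\<^sup>2 + 1 / w) * ?E"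
        unfolding norm_mult using E w by (intro mult_mono) auto
      also have "\<dots> = ?E * w * (norm (ker n x t))\<^sup>2 + ?E / w" by (simp add: algebra_simps)
      finally show ?thesis
        using t w by (simp add: ennreal_mult[symmetric] ennreal_plus[symmetric] abs_le_iff del: ennreal_plus)
    qed (simp add: ker_outside)
  qed
  also have "\<dots> = ennreal (?E * w) * (\<integral>\<^sup>+t. ennreal ((norm (ker n x t))\<^sup>2) \<partial>lborel) + ennreal (?E / w) * (\<integral>\<^sup>+t. indicator {-l..l} t \<partial>lborel)"
    by (subst nn_integral_add, measurable, subst (1 2) nn_integral_cmult) auto
  also have "\<dots> \<le> ennreal (?E * w) * ennreal (D / 2 * (D * l) ^ n / fact n) + ennreal (?E / w) * ennreal (2 * l)"
  proof (intro add_mono mult_left_mono)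
    have "(\<integral>\<^sup>+t. ennreal ((norm (ker n x t))\<^sup>2) \<partial>lborel) \<le> ennreal (D / 2 * (D * x) ^ n / fact n)"
      by (rule ker_square_bound[OF x])
    also have "\<dots> \<le> ennreal (D / 2 * (D * l) ^ n / fact n)"
      using x D_nonneg by (intro ennreal_leI divide_right_mono mult_left_mono power_mono) auto
    finally show "(\<integral>\<^sup>+t. ennreal ((norm (ker n x t))\<^sup>2) \<partial>lborel) \<le> ennreal (D / 2 * (D * l) ^ n / fact n)" .
  qed (use x in auto)
  also have "\<dots> = ennreal (?E * (w * (D / 2 * (D * l) ^ n / fact n) + 2 * l / w))"
    using w x D_nonneg by (simp add: ennreal_mult[symmetric] ennreal_plus[symmetric] algebra_simps del: ennreal_plus)
  finally show ?thesis .
qed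

lemma ker_exp_integrable:
  assumes x: "x \<in> {0..l}"
  shows "integrable lborel (\<lambda>t. ker n x t * exp (\<i> * \<rho> * of_real t))"
proof (rule integrableI_bounded)
  note [measurable] = measurable_ker
  show "(\<lambda>t. ker n x t * exp (\<i> * \<rho> * of_real t)) \<in> borel_measurable lborel" by measurable
  show "(\<integral>\<^sup>+t. ennreal (norm (ker n x t * exp (\<i> * \<rho> * of_real t))) \<partial>lborel) < \<infinity>"
    using ker_exp_nn_integral[OF x, of 1 n \<rho>] by (auto intro: le_less_trans)
qed

text \<open>This is the link that removes \<rho> from the kernels: after Fubini, the inner integral
  over t is a translated copy of the induction hypothesis.\<close>

lemma integral_ker_exp:
  assumes "x \<in> {0..l}"
  shows "(LINT t|lborel. ker n x t * exp (\<i> * \<rho> * of_real t)) = iter \<rho> (\<lambda>x. exp (\<i> * \<rho> * of_real x)) (Suc n) x"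
  using assms
proof (induction n arbitrary: x)
  case 0
  \<comment> \<open>The substitution t = 2 s - x maps 0 < s < x onto |t| < x; its Jacobian 2 cancels
    the factor 1/2 in \<open>ker 0\<close>.\<close>
  have "(LINT t|lborel. ker 0 x t * exp (\<i> * \<rho> * of_real t))
    = 2 *\<^sub>R (LINT s|lborel. ker 0 x (- x + 2 * s) * exp (\<i> * \<rho> * of_real (- x + 2 * s)))"
    by (subst lborel_integral_real_affine[of 2 _ "- x"]) auto
  also have "\<dots> = (LINT s|lborel. 2 *\<^sub>R (ker 0 x (- x + 2 * s) * exp (\<i> * \<rho> * of_real (- x + 2 * s))))"
    by simp
  also have "\<dots> = (LINT s:{0<..<x}|lborel. p s * exp (phase \<rho> 0 * of_real (x - s)) * exp (\<i> * \<rho> * of_real s))"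
    unfolding set_lebesgue_integral_def
  proof (intro Bochner_Integration.integral_cong refl)
    fix s
    have "exp (\<i> * \<rho> * of_real (- x + 2 * s)) = exp (phase \<rho> 0 * of_real (x - s)) * exp (\<i> * \<rho> * of_real s)"
      by (simp add: phase_def algebra_simps flip: exp_add)
    moreover have "\<bar>- x + 2 * s\<bar> < x \<longleftrightarrow> 0 < s \<and> s < x" by auto
    ultimately show "2 *\<^sub>R (ker 0 x (- x + 2 * s) * exp (\<i> * \<rho> * of_real (- x + 2 * s)))
      = indicator {0<..<x} s *\<^sub>R (p s * exp (phase \<rho> 0 * of_real (x - s)) * exp (\<i> * \<rho> * of_real s))"
      by (simp add: indicator_def scaleR_conv_of_real)
  qed
  finally show ?case by (simp add: volterra_def)
next
  case (Suc n)
  note [measurable] = measurable_ker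
  let ?e = "\<lambda>t::real. exp (\<i> * \<rho> * of_real t)"
  let ?d = "\<lambda>s. (- 1) ^ Suc n * (x - s) :: real"
  define F where "F t s = indicator {0<..<x} s *\<^sub>R (p s * ker n s (t + ?d s)) * ?e t" for t s
  have [measurable]: "case_prod F \<in> borel_measurable (lborel \<Otimes>\<^sub>M lborel)"
    unfolding F_def by measurable
  \<comment> \<open>Translating t by the shift costs exactly the phase factor of the next Volterra
    step; this fixes the sign of the shift in \<open>ker\<close>.\<close>
  have e_shift: "?e t = exp (phase \<rho> (Suc n) * of_real (x - s)) * ?e (t + ?d s)" for t s
  proof -
    have "phase \<rho> (Suc n) * of_real (x - s) + \<i> * \<rho> * of_real (t + ?d s) = \<i> * \<rho> * of_real t"
      by (simp add: phase_def algebra_simps)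
    then show ?thesis by (simp only: flip: exp_add)
  qed
  have inner: "(LINT t|lborel. F t s) = indicator {0<..<x} s *\<^sub>R (p s * exp (phase \<rho> (Suc n) * of_real (x - s)) * iter \<rho> ?e (Suc n) s)" for s
  proof (cases "s \<in> {0<..<x}")
    case True
    then have s: "s \<in> {0..l}" using Suc.prems by auto
    have "(LINT t|lborel. F t s) = (LINT t|lborel. (p s * exp (phase \<rho> (Suc n) * of_real (x - s))) * (ker n s (t + ?d s) * ?e (t + ?d s)))"
      unfolding F_def using True by (subst e_shift[of _ s]) (simp add: mult_ac)
    also have "\<dots> = p s * exp (phase \<rho> (Suc n) * of_real (x - s)) * (LINT t|lborel. ker n s (t + ?d s) * ?e (t + ?d s))"
      by (rule integral_mult_right_zero)
    also have "(LINT t|lborel. ker n s (t + ?d s) * ?e (t + ?d s)) = (LINT t|lborel. ker n s t * ?e t)"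
      using lborel_integral_real_affine[of 1 "\<lambda>t. ker n s t * ?e t" "?d s"] by (simp add: add.commute)
    finally show ?thesis using Suc.IH[OF s] True by simp
  qed (simp add: F_def)
  \<comment> \<open>For fixed s the integral over t is at most a constant times |p(s)|, and
    \<open>p\<close> is integrable since it vanishes off a bounded interval.\<close>
  have "integrable (lborel \<Otimes>\<^sub>M lborel) (case_prod F)"
  proof (rule integrableI_bounded)
    let ?E = "exp (norm \<rho> * l)"
    define B where "B = exp (norm \<rho> * l) * (1 * (D / 2 * (D * l) ^ n / fact n) + 2 * l / 1)"
    have "(\<integral>\<^sup>+z. ennreal (norm (case_prod F z)) \<partial>(lborel \<Otimes>\<^sub>M lborel)) = (\<integral>\<^sup>+s. (\<integral>\<^sup>+t. ennreal (norm (F t s)) \<partial>lborel) \<partial>lborel)"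
      by (subst lborel_pair.nn_integral_snd[symmetric]) auto
    also have "\<dots> \<le> (\<integral>\<^sup>+s. ennreal (norm (p s * of_real (?E * B))) \<partial>lborel)"
    proof (intro nn_integral_mono)
      fix s
      show "(\<integral>\<^sup>+t. ennreal (norm (F t s)) \<partial>lborel) \<le> ennreal (norm (p s * of_real (?E * B)))"
      proof (cases "s \<in> {0<..<x}")
        case True
        then have s: "s \<in> {0..l}" using Suc.prems by auto
        have B: "(\<integral>\<^sup>+t. ennreal (norm (ker n s t * ?e t)) \<partial>lborel) \<le> ennreal B"
          unfolding B_def by (rule ker_exp_nn_integral[OF s]) simp
        have B0: "0 \<le> B" using D_nonneg s by (auto simp: B_def intro!: mult_nonneg_nonneg add_nonneg_nonneg)
        have E: "norm (exp (phase \<rho> (Suc n) * of_real (x - s))) \<le> ?E"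
          using norm_exp_le[of "x - s" "phase \<rho> (Suc n)"] True Suc.prems by (simp add: norm_phase)
        have "norm (F t s) \<le> norm (p s) * ?E * norm (ker n s (t + ?d s) * ?e (t + ?d s))" for t
        proof -
          have "norm (F t s) = norm (p s) * norm (exp (phase \<rho> (Suc n) * of_real (x - s))) * norm (ker n s (t + ?d s) * ?e (t + ?d s))"
            unfolding F_def using True by (subst e_shift[of _ s]) (simp add: norm_mult mult_ac)
          also have "\<dots> \<le> norm (p s) * ?E * norm (ker n s (t + ?d s) * ?e (t + ?d s))"
            using E by (intro mult_right_mono mult_left_mono) auto
          finally show ?thesis .
        qed
        then have "(\<integral>\<^sup>+t. ennreal (norm (F t s)) \<partial>lborel)
          \<le> (\<integral>\<^sup>+t. ennreal (norm (p s) * ?E) * ennreal (norm (ker n s (t + ?d s) * ?e (t + ?d s))) \<partial>lborel)"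
          by (intro nn_integral_mono) (simp add: ennreal_mult[symmetric] ennreal_leI)
        also have "\<dots> = ennreal (norm (p s) * ?E) * (\<integral>\<^sup>+t. ennreal (norm (ker n s (t + ?d s) * ?e (t + ?d s))) \<partial>lborel)"
          by (rule nn_integral_cmult) measurable
        also have "(\<integral>\<^sup>+t. ennreal (norm (ker n s (t + ?d s) * ?e (t + ?d s))) \<partial>lborel) = (\<integral>\<^sup>+t. ennreal (norm (ker n s t * ?e t)) \<partial>lborel)"
          by (rule nn_integral_shift[of "\<lambda>t. ennreal (norm (ker n s t * ?e t))"]) measurable
        also have "ennreal (norm (p s) * ?E) * \<dots> \<le> ennreal (norm (p s) * ?E) * ennreal B"
          by (intro mult_left_mono B) simp
        also have "\<dots> = ennreal (norm (p s * of_real (?E * B)))"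
          using B0 by (simp add: ennreal_mult[symmetric] norm_mult mult.assoc)
        finally show ?thesis .
      qed (simp add: F_def)
    qed
    also have "\<dots> < \<infinity>"
    proof -
      have "integrable lborel (\<lambda>s. p s * of_real (?E * B))"
        by (rule integrable_p_mult[where B = "\<bar>?E * B\<bar>"]) (simp, simp only: norm_of_real order_refl)
      then show ?thesis unfolding integrable_iff_bounded by blast
    qed
    finally show "(\<integral>\<^sup>+z. ennreal (norm (case_prod F z)) \<partial>(lborel \<Otimes>\<^sub>M lborel)) < \<infinity>" .
  qed simp
  from lborel_pair.Fubini_integral[OF this]
  have "(LINT t|lborel. (LINT s|lborel. F t s)) = (LINT s|lborel. (LINT t|lborel. F t s))" by simp
  moreover have "(LINT s|lborel. F t s) = ker (Suc n) x t * ?e t" for t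
    unfolding F_def ker.simps set_lebesgue_integral_def by (rule integral_mult_left_zero)
  moreover have "(LINT s|lborel. (LINT t|lborel. F t s)) = iter \<rho> ?e (Suc (Suc n)) x"
    unfolding inner iter.simps(2)[of _ _ "Suc n"] volterra_def set_lebesgue_integral_def ..
  ultimately show ?case by simp
qed

text \<open>
  Where the series diverges, \<open>kernel\<close> has an arbitrary value; there \<open>majorant\<close> is infinite, which
  for each \<open>x \<in> [0, l]\<close> happens only for a null set of \<open>t\<close>.
\<close>

definition kernel :: "real \<times> real \<Rightarrow> complex" where
  "kernel z = (\<Sum>n. ker n (fst z) (snd z))"

definition majorant :: "real \<Rightarrow> real \<Rightarrow> ennreal" where
  "majorant x t = (\<Sum>n. ennreal (4 ^ n * (norm (ker n x t))\<^sup>2))"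

lemma measurable_kernel: "kernel \<in> borel_measurable borel"
proof -
  note [measurable] = measurable_ker
  have "kernel \<in> borel_measurable (borel \<Otimes>\<^sub>M borel)"
    unfolding kernel_def[abs_def] by measurable
  then show ?thesis by (simp add: borel_prod)
qed

lemma measurable_majorant:
  assumes [measurable]: "a \<in> borel_measurable M" "b \<in> borel_measurable M"
  shows "(\<lambda>w. majorant (a w) (b w)) \<in> borel_measurable M"
proof -
  note [measurable] = measurable_ker
  show ?thesis unfolding majorant_def by measurable
qed

lemma kernel_le_majorant: "ennreal ((norm (kernel (x, t)))\<^sup>2) \<le> 2 * majorant x t"
proof (cases "majorant x t = \<infinity>")
  case True
  then show ?thesis unfolding True by (simp add: ennreal_mult_top)
next
  case False
  then have "(\<Sum>n. ennreal (4 ^ n * (norm (ker n x t))\<^sup>2)) < \<infinity>"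
    unfolding majorant_def infinity_ennreal_def by (simp only: less_top)
  from weighted_square_summable(2)[OF this] show ?thesis
    unfolding majorant_def kernel_def fst_conv snd_conv .
qed

text \<open>The weights \<open>4 ^ n\<close> merely enlarge the argument of the exponential series.
  The bound is uniform in x, so square integrability on the triangle follows by integrating over
  \<open>[0, l]\<close>.\<close>

lemma majorant_integral:
  assumes x: "x \<in> {0..l}"
  shows "(\<integral>\<^sup>+t. majorant x t \<partial>lborel) \<le> ennreal (D / 2 * exp (4 * D * l))"
proof -
  note [measurable] = measurable_ker
  note exp_sums = sums_mult[OF exp_converges[of "4 * D * l", unfolded real_scaleR_def], of "D / 2"]
  have "(\<integral>\<^sup>+t. majorant x t \<partial>lborel) = (\<Sum>n. \<integral>\<^sup>+t. ennreal (4 ^ n * (norm (ker n x t))\<^sup>2) \<partial>lborel)"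
    unfolding majorant_def by (rule nn_integral_suminf) simp
  also have "\<dots> \<le> (\<Sum>n. ennreal (D / 2 * (inverse (fact n) * (4 * D * l) ^ n)))"
  proof (rule suminf_le)
    fix n
    have "(\<integral>\<^sup>+t. ennreal (4 ^ n * (norm (ker n x t))\<^sup>2) \<partial>lborel) = ennreal (4 ^ n) * (\<integral>\<^sup>+t. ennreal ((norm (ker n x t))\<^sup>2) \<partial>lborel)"
      unfolding ennreal_mult[OF zero_le_power[OF zero_le_numeral] zero_le_power2]
      by (rule nn_integral_cmult) simp
    also have "\<dots> \<le> ennreal (4 ^ n) * ennreal (D / 2 * (D * x) ^ n / fact n)"
      by (intro mult_left_mono ker_square_bound x) simp
    also have "\<dots> = ennreal (4 ^ n * (D / 2 * (D * x) ^ n / fact n))"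
      using D_nonneg x by (intro ennreal_mult[symmetric]) auto
    also have "\<dots> \<le> ennreal (4 ^ n * (D / 2 * (D * l) ^ n / fact n))"
      using x D_nonneg by (intro ennreal_leI mult_left_mono divide_right_mono power_mono) auto
    also have "4 ^ n * (D / 2 * (D * l) ^ n / fact n) = D / 2 * (inverse (fact n) * (4 * D * l) ^ n)"
      by (simp only: power_mult_distrib divide_inverse mult_ac)
    finally show "(\<integral>\<^sup>+t. ennreal (4 ^ n * (norm (ker n x t))\<^sup>2) \<partial>lborel) \<le> ennreal (D / 2 * (inverse (fact n) * (4 * D * l) ^ n))" .
  qed auto
  also have "\<dots> = ennreal (\<Sum>n. D / 2 * (inverse (fact n) * (4 * D * l) ^ n))"
    by (rule suminf_ennreal2[OF _ sums_summable[OF exp_sums]]) (use D_nonneg x in simp)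
  also have "(\<Sum>n. D / 2 * (inverse (fact n) * (4 * D * l) ^ n)) = D / 2 * exp (4 * D * l)"
    by (rule sums_unique[OF exp_sums, symmetric])
  finally show ?thesis .
qed

lemma kernel_L2: "kernel \<in> L2 (triangle_dom l)"
proof -
  note [measurable] = measurable_kernel measurable_majorant
  have "closed (triangle_dom l)"
    unfolding triangle_dom_def case_prod_unfold
    by (intro closed_Collect_conj closed_Collect_le continuous_intros)
  then have [measurable]: "triangle_dom l \<in> sets borel" by (rule borel_closed)
  have "integrable lborel (\<lambda>z. indicator (triangle_dom l) z *\<^sub>R (norm (kernel z))\<^sup>2)"
  proof (rule integrableI_bounded)
    have "(\<integral>\<^sup>+z. ennreal (norm (indicator (triangle_dom l) z *\<^sub>R (norm (kernel z))\<^sup>2)) \<partial>lborel)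
      \<le> (\<integral>\<^sup>+z. indicator {0..l} (fst z) * (2 * majorant (fst z) (snd z)) \<partial>lborel)"
      using kernel_le_majorant
      by (intro nn_integral_mono) (auto simp: indicator_def triangle_dom_def)
    also have "\<dots> = (\<integral>\<^sup>+z. indicator {0..l} (fst z) * (2 * majorant (fst z) (snd z)) \<partial>(lborel \<Otimes>\<^sub>M lborel))"
      by (simp add: lborel_prod)
    also have "\<dots> = (\<integral>\<^sup>+x. (\<integral>\<^sup>+t. indicator {0..l} x * (2 * majorant x t) \<partial>lborel) \<partial>lborel)"
      by (subst lborel.nn_integral_fst[symmetric]) simp_all
    also have "\<dots> \<le> (\<integral>\<^sup>+x. (2 * ennreal (D / 2 * exp (4 * D * l))) * indicator {0..l} x \<partial>lborel)"
    proof (intro nn_integral_mono)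
      fix x :: real
      have "(\<integral>\<^sup>+t. 2 * majorant x t \<partial>lborel) = 2 * (\<integral>\<^sup>+t. majorant x t \<partial>lborel)"
        by (rule nn_integral_cmult) measurable
      then show "(\<integral>\<^sup>+t. indicator {0..l} x * (2 * majorant x t) \<partial>lborel)
          \<le> 2 * ennreal (D / 2 * exp (4 * D * l)) * indicator {0..l} x"
        using mult_left_mono[OF majorant_integral, of x 2] by (auto simp: indicator_def)
    qed
    also have "\<dots> = 2 * ennreal (D / 2 * exp (4 * D * l)) * emeasure lborel {0..l}"
      by (rule nn_integral_cmult_indicator) simp
    also have "\<dots> < \<infinity>"
      by (cases "0 \<le> l") (auto simp: ennreal_mult_less_top)
    finally show "(\<integral>\<^sup>+z. ennreal (norm (indicator (triangle_dom l) z *\<^sub>R (norm (kernel z))\<^sup>2)) \<partial>lborel) < \<infinity>" .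
  qed measurable
  moreover have "(\<lambda>z. indicator (triangle_dom l) z *\<^sub>R kernel z) \<in> borel_measurable lborel" by measurable
  ultimately show ?thesis by (simp add: L2_def set_borel_measurable_def set_integrable_def)
qed

text \<open>Termwise integration of the series: it needs absolute convergence for almost every t,
  supplied by the majorant, and summability of the norms in L1(dt).\<close>

lemma kernel_integral:
  assumes x: "x \<in> {0<..<l}"
    and sums: "(\<lambda>n. iter \<rho> (\<lambda>x. exp (\<i> * \<rho> * of_real x)) n x) sums Y"
  shows "set_integrable lborel {-x..x} (\<lambda>t. kernel (x, t) * exp (\<i> * \<rho> * of_real t))"
    and "Y = exp (\<i> * \<rho> * of_real x) + (LINT t:{-x..x}|lborel. kernel (x, t) * exp (\<i> * \<rho> * of_real t))"
proof -
  let ?e = "\<lambda>t::real. exp (\<i> * \<rho> * of_real t)"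
  let ?f = "\<lambda>n t. ker n x t * ?e t"
  have x': "x \<in> {0..l}" using x by auto
  note int = ker_exp_integrable[OF x']
  have "AE t in lborel. majorant x t \<noteq> \<infinity>"
  proof (rule nn_integral_PInf_AE)
    show "(\<lambda>t. majorant x t) \<in> borel_measurable lborel" by (intro measurable_majorant) auto
    show "(\<integral>\<^sup>+t. majorant x t \<partial>lborel) \<noteq> \<infinity>"
      using majorant_integral[OF x'] by (auto simp: top_unique)
  qed
  then have AE_summable: "AE t in lborel. summable (\<lambda>n. norm (?f n t))"
  proof eventually_elim
    case (elim t)
    then have "summable (\<lambda>n. norm (ker n x t))"
      by (intro weighted_square_summable(1)) (simp add: majorant_def less_top)
    then show ?case unfolding norm_mult by (rule summable_mult2)
  qed
  have summ: "summable (\<lambda>n. LINT t|lborel. norm (?f n t))"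
  proof (rule summable_comparison_test')
    let ?b = "\<lambda>n. exp (norm \<rho> * l) * (D / 2 * (inverse (fact n) * (2 * (D * l)) ^ n) + 2 * l * (1 / 2) ^ n)"
    show "summable ?b"
      by (intro summable_mult summable_add summable_exp summable_geometric) auto
    fix n
    have "ennreal (LINT t|lborel. norm (?f n t)) = (\<integral>\<^sup>+t. ennreal (norm (?f n t)) \<partial>lborel)"
      by (rule nn_integral_eq_integral[symmetric]) (use integrable_norm[OF int] in auto)
    \<comment> \<open>Here the weight is w = 2^n: the factorial absorbs it in the first part, and
      the second part becomes geometric.\<close>
    also have "\<dots> \<le> ennreal (exp (norm \<rho> * l) * (2 ^ n * (D / 2 * (D * l) ^ n / fact n) + 2 * l / 2 ^ n))"
      by (rule ker_exp_nn_integral[OF x']) simp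
    also have "exp (norm \<rho> * l) * (2 ^ n * (D / 2 * (D * l) ^ n / fact n) + 2 * l / 2 ^ n) = ?b n"
      by (simp only: power_mult_distrib power_one_over divide_inverse mult_ac power_inverse mult_1_left)
    finally show "norm (LINT t|lborel. norm (?f n t)) \<le> ?b n"
      using x D_nonneg by (subst (asm) ennreal_le_iff) auto
  qed
  have kernel_eq: "AE t in lborel. (\<Sum>n. ?f n t) = indicator {-x..x} t *\<^sub>R (kernel (x, t) * ?e t)"
    using AE_summable
  proof eventually_elim
    case (elim t)
    have "summable (\<lambda>n. ker n x t)"
    proof -
      have "summable (\<lambda>n. norm (?f n t) * inverse (norm (?e t)))"
        by (rule summable_mult2[OF elim])
      then have "summable (\<lambda>n. norm (ker n x t))"
        by (simp add: norm_mult mult.assoc del: norm_exp_eq_Re)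
      then show ?thesis by (rule summable_norm_cancel)
    qed
    then have "(\<Sum>n. ?f n t) = kernel (x, t) * ?e t"
      by (simp add: kernel_def suminf_mult2)
    moreover have "kernel (x, t) = 0" if "t \<notin> {-x..x}"
    proof -
      have "x \<le> \<bar>t\<bar>" using that by auto
      then show ?thesis by (simp add: kernel_def ker_outside)
    qed
    ultimately show ?case by (auto simp: indicator_def)
  qed
  have meas: "(\<lambda>t. indicator {-x..x} t *\<^sub>R (kernel (x, t) * ?e t)) \<in> borel_measurable lborel"
  proof -
    have "(\<lambda>t. kernel (x, t)) \<in> borel_measurable borel"
      using measurable_compose[OF _ measurable_kernel, of "\<lambda>t. (x, t)"] by simp
    then show ?thesis by measurable
  qed
  have sum_int: "integrable lborel (\<lambda>t. \<Sum>n. ?f n t)"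
    by (rule integrable_suminf[OF int AE_summable summ])
  show "set_integrable lborel {-x..x} (\<lambda>t. kernel (x, t) * ?e t)"
    unfolding set_integrable_def by (rule integrable_cong_AE_imp[OF sum_int meas kernel_eq])
  have "(\<lambda>n. LINT t|lborel. ?f n t) sums (LINT t|lborel. (\<Sum>n. ?f n t))"
    by (rule sums_integral[OF int AE_summable summ])
  also have "(LINT t|lborel. (\<Sum>n. ?f n t)) = (LINT t:{-x..x}|lborel. kernel (x, t) * ?e t)"
    unfolding set_lebesgue_integral_def
    by (intro integral_cong_AE kernel_eq meas borel_measurable_integrable[OF sum_int])
  finally have "(\<lambda>n. iter \<rho> ?e (Suc n) x) sums (LINT t:{-x..x}|lborel. kernel (x, t) * ?e t)"
    unfolding integral_ker_exp[OF x'] .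
  \<comment> \<open>The kernels start with the first Volterra step, so the index is shifted back and
    the free exponential joins as term 0.\<close>
  then have "(\<lambda>n. iter \<rho> ?e n x) sums ((LINT t:{-x..x}|lborel. kernel (x, t) * ?e t) + iter \<rho> ?e 0 x)"
    by (rule sums_Suc)
  from sums_unique2[OF sums this] show "Y = ?e x + (LINT t:{-x..x}|lborel. kernel (x, t) * ?e t)"
    by (simp only: iter.simps(1) add.commute)
qed

end

theorem theorem19:
  fixes l :: real
    and f :: "real \<Rightarrow> complex"
    and e :: "complex \<Rightarrow> real \<Rightarrow> complex"
  assumes "l > 0"
    and "f \<in> W12 l"
    and "\<forall>x\<in>{0..l}. f x \<noteq> 0"
    and "f 0 = 1"
    and "\<And>\<rho>. is_e_solution l f \<rho> (e \<rho>)"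
  shows "\<exists>K\<in>L2 (triangle_dom l). \<forall>\<rho> x. 0 < x \<and> x < l \<longrightarrow>
           set_integrable lborel {-x..x} (\<lambda>t. K (x, t) * exp (\<i> * \<rho> * of_real t)) \<and>
           e \<rho> x = exp (\<i> * \<rho> * of_real x) +
             (LINT t:{-x..x}|lborel. K (x, t) * exp (\<i> * \<rho> * of_real t))"
proof -
  define p where "p x = indicator {0<..<l} x *\<^sub>R (wderiv l f x / f x)" for x
  have p: "p x = wderiv l f x / f x" if "x \<in> {0<..<l}" for x
    using that by (simp add: p_def)
  have "p \<in> L2 {0<..<l}"
    \<comment> \<open>Square integrability of \<open>p\<close> does not involve \<rho>; the solution
      at \<rho> = 0 is just one instance from which to read it off.\<close>
    using e_solution_system[OF assms(2,3) assms(5)[of 0] p] by blast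
  moreover have "(\<lambda>x. indicator {0<..<l} x *\<^sub>R p x) = p"
    "(\<lambda>x. indicat_real {0<..<l} x *\<^sub>R (norm (p x))\<^sup>2) = (\<lambda>x. (norm (p x))\<^sup>2)"
    by (auto simp: p_def indicator_def)
  ultimately have "p \<in> borel_measurable borel" "integrable lborel (\<lambda>x. (norm (p x))\<^sup>2)"
    by (simp_all only: L2_def set_borel_measurable_def set_integrable_def mem_Collect_eq measurable_lborel2)
  then interpret l2_potential l p
    by unfold_locales (simp_all add: p_def)
  have sums: "(\<lambda>n. iter \<rho> (\<lambda>x. exp (\<i> * \<rho> * of_real x)) n x) sums e \<rho> x" if x: "x \<in> {0..l}" for \<rho> x
  proof (cases "\<rho> = 0")
    case True
    obtain v where v: "continuous_on {0..l} (e 0)" "continuous_on {0..l} v"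
      "\<And>x. x \<in> {0..l} \<Longrightarrow> v x = volterra p 0 (\<lambda>x. - v x) x"
      "\<And>x. (\<And>s. s \<in> {0..l} \<Longrightarrow> v s = 0) \<Longrightarrow> x \<in> {0..l} \<Longrightarrow> e 0 x = 1 + volterra p 0 (e 0) x"
      using e_solution_volterra_0[OF assms(2,3,5) p] by blast
    have v0: "v s = 0" if "s \<in> {0..l}" for s
      by (rule volterra_fixed_point_0[OF v(2,3) that])
    \<comment> \<open>The vanishing of \<open>v\<close> discharges the condition attached to the
      equation for \<open>e 0\<close>.\<close>
    have "e 0 s = 1 + volterra p 0 (e 0) s" if "s \<in> {0..l}" for s
      using v(4)[of s] v0 that by blast
    from iter_exp_sums_0[OF v(1) this x] show ?thesis by (simp add: True)
  next
    case False
    obtain a b where ab: "continuous_on {0..l} a" "continuous_on {0..l} b" "\<And>x. e \<rho> x = a x + b x"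
      "\<And>x. x \<in> {0..l} \<Longrightarrow> a x = exp (\<i> * \<rho> * of_real x) + volterra p (\<i> * \<rho>) b x"
      "\<And>x. x \<in> {0..l} \<Longrightarrow> b x = volterra p (- \<i> * \<rho>) a x"
      using e_solution_volterra[OF assms(2,3,5) False p] by blast
    show ?thesis unfolding ab(3) by (rule iter_exp_sums[OF ab(1,2,4,5) x])
  qed
  show ?thesis
    using kernel_L2 kernel_integral[OF _ sums] by (intro bexI[of _ kernel]) auto
qed

end
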